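(* Let $n\geq 15$ with $n\equiv 3\pmod 4$ and $r=6$. Let $V=\{x_1,\dots,x_{n-10}\}\sqcup\{a,b,c,d,e,f,g,h,k,m\}$ and consider the labelled graph on $V$ with edges: a terminal-1 alternating path on $x_1,\dots,x_{n-10}$; $\{x_{n-10},a\}$ with label $2$; $\{a,b\}$ with label $3$; $\{b,c\}$ with label $4$; $\{c,d\}$ with label $5$; $\{e,f\}$ with label $5$; $\{f,g\}$ with label $4$; $\{c,e\}$ and $\{d,f\}$ with label $3$; $\{h,k\}$ with label $5$; $\{k,m\}$ with label $4$; $\{h,e\}$ with the two labels $2$ and $4$; $\{k,f\}$ with label $2$; and $\{m,g\}$ with the three labels $2,3,5$. Then $G\cong A_n$ and $(G,(\rho_0,\dots,\rho_5))$ is a string C-group of rank 6 with Schläfli type $\{n-10,6,3,5,3\}$.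
   Context: A string group generated by involutions (sggi) of rank $r$ is a pair $(G,(\rho_0,\dots,\rho_{r-1}))$ where $\rho_0,\dots,\rho_{r-1}$ are involutions generating the group $G$ such that $(\rho_i\rho_j)^2=1$ whenever $|i-j|\geq 2$. It is a string C-group if in addition it satisfies the intersection property: for all $J,K\subseteq\{0,\dots,r-1\}$, $\langle \rho_j : j\in J\rangle\cap\langle\rho_k : k\in K\rangle=\langle \rho_j : j\in J\cap K\rangle$. The Schläfli type is $\{p_1,\dots,p_{r-1}\}$ where $p_i$ is the order of $\rho_{i-1}\rho_i$. Labelled-graph convention: the vertex set $V$ is finite, and each edge $\{a,b\}$ ($a\neq b$) carries one or more labels from $\{0,\dots,r-1\}$, the edges carrying any given label being pairwise disjoint; $\rho_k$ denotes the permutation of $V$ equal to the product of the transpositions $(a\,b)$ over all edges $\{a,b\}$ carrying label $k$, and $G=\langle\rho_0,\dots,\rho_{r-1}\rangle\leq \mathrm{Sym}(V)$. A terminal-1 alternating path on vertices $v_1,\dots,v_a$ means the edges $\{v_s,v_{s+1}\}$ ($1\leq s\leq a-1$), where $\{v_s,v_{s+1}\}$ carries label $1$ if $a-s$ is odd and label $0$ if $a-s$ is even (so the last edge carries label 1 and labels alternate; if $a=1$ there are no edges). *)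

theory Defs
  imports "HOL-Algebra.Sym_Groups" "HOL-Algebra.Multiplicative_Group" "HOL-Algebra.Generated_Groups"
begin

definition perm_group :: "'a set \<Rightarrow> ('a \<Rightarrow> 'a) monoid" where
  "perm_group S = \<lparr> carrier = {p. p permutes S}, mult = (\<circ>), one = id \<rparr>"

definition sggi :: "('a, 'b) monoid_scheme \<Rightarrow> nat \<Rightarrow> (nat \<Rightarrow> 'a) \<Rightarrow> bool" where
  "sggi G r \<rho> \<longleftrightarrow> group G
     \<and> (\<forall>i<r. \<rho> i \<in> carrier G \<and> \<rho> i \<noteq> \<one>\<^bsub>G\<^esub> \<and> \<rho> i \<otimes>\<^bsub>G\<^esub> \<rho> i = \<one>\<^bsub>G\<^esub>)
     \<and> generate G (\<rho> ` {..<r}) = carrier G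
     \<and> (\<forall>i<r. \<forall>j<r. (i + 2 \<le> j \<or> j + 2 \<le> i) \<longrightarrow>
           (\<rho> i \<otimes>\<^bsub>G\<^esub> \<rho> j) [^]\<^bsub>G\<^esub> (2::nat) = \<one>\<^bsub>G\<^esub>)"

definition intersection_property :: "('a, 'b) monoid_scheme \<Rightarrow> nat \<Rightarrow> (nat \<Rightarrow> 'a) \<Rightarrow> bool" where
  "intersection_property G r \<rho> \<longleftrightarrow>
     (\<forall>J K. J \<subseteq> {..<r} \<longrightarrow> K \<subseteq> {..<r} \<longrightarrow>
        generate G (\<rho> ` J) \<inter> generate G (\<rho> ` K) = generate G (\<rho> ` (J \<inter> K)))"

definition string_C_group :: "('a, 'b) monoid_scheme \<Rightarrow> nat \<Rightarrow> (nat \<Rightarrow> 'a) \<Rightarrow> bool" where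
  "string_C_group G r \<rho> \<longleftrightarrow> sggi G r \<rho> \<and> intersection_property G r \<rho>"

definition schlafli_type :: "('a, 'b) monoid_scheme \<Rightarrow> nat \<Rightarrow> (nat \<Rightarrow> 'a) \<Rightarrow> nat list \<Rightarrow> bool" where
  "schlafli_type G r \<rho> ps \<longleftrightarrow> length ps = r - 1 \<and>
     (\<forall>i. 1 \<le> i \<and> i < r \<longrightarrow> group.ord G (\<rho> (i - 1) \<otimes>\<^bsub>G\<^esub> \<rho> i) = ps ! (i - 1))"

text \<open>A labelled graph is given by a set of pairs (edge, label), an edge being a 2-element set;
  an edge carrying several labels occurs once per label.\<close>

definition lg_wellformed :: "'v set \<Rightarrow> ('v set \<times> nat) set \<Rightarrow> bool" where
  "lg_wellformed V E \<longleftrightarrow> finite V \<and>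
     (\<forall>(e, k) \<in> E. \<exists>a b. a \<noteq> b \<and> a \<in> V \<and> b \<in> V \<and> e = {a, b}) \<and>
     (\<forall>(e, k) \<in> E. \<forall>(e', k') \<in> E. k = k' \<and> e \<noteq> e' \<longrightarrow> e \<inter> e' = {})"

text \<open>rho_k: product of the transpositions (a b) over the edges {a,b} carrying label k
  (well defined since those edges are pairwise disjoint).\<close>
definition lg_perm :: "('v set \<times> nat) set \<Rightarrow> nat \<Rightarrow> 'v \<Rightarrow> 'v" where
  "lg_perm E k v = (if \<exists>w. w \<noteq> v \<and> ({v, w}, k) \<in> E
                    then (THE w. w \<noteq> v \<and> ({v, w}, k) \<in> E) else v)"

definition alt_path_edges :: "'v list \<Rightarrow> ('v set \<times> nat) set" where
  "alt_path_edges xs = {({xs ! (s - 1), xs ! s}, if odd (length xs - s) then 1 else 0) | s.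
                          1 \<le> s \<and> s \<le> length xs - 1}"

datatype vert = X nat | Va | Vb | Vc | Vd | Ve | Vf | Vg | Vh | Vk | Vm

definition verts413 :: "nat \<Rightarrow> vert set" where
  "verts413 n = {X i | i. 1 \<le> i \<and> i \<le> n - 10} \<union> {Va, Vb, Vc, Vd, Ve, Vf, Vg, Vh, Vk, Vm}"

definition edges413 :: "nat \<Rightarrow> (vert set \<times> nat) set" where
  "edges413 n = alt_path_edges (map X [1..<n - 9]) \<union>
     { ({X (n - 10), Va}, 2), ({Va, Vb}, 3), ({Vb, Vc}, 4), ({Vc, Vd}, 5),
       ({Ve, Vf}, 5), ({Vf, Vg}, 4), ({Vc, Ve}, 3), ({Vd, Vf}, 3),
       ({Vh, Vk}, 5), ({Vk, Vm}, 4), ({Vh, Ve}, 2), ({Vh, Ve}, 4),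
       ({Vk, Vf}, 2), ({Vm, Vg}, 2), ({Vm, Vg}, 3), ({Vm, Vg}, 5) }"

definition rho413 :: "nat \<Rightarrow> nat \<Rightarrow> vert \<Rightarrow> vert" where
  "rho413 n k = lg_perm (edges413 n) k"

definition group413 :: "nat \<Rightarrow> (vert \<Rightarrow> vert) monoid" where
  "group413 n = subgroup_generated (perm_group (verts413 n)) (rho413 n ` {..<6})"

end

theory Submission
  imports Defs
begin

text \<open>
  Let \<open>L = n - 10\<close>. Write \<open>M i\<close> for the subgroup generated by all \<open>\<rho> j\<close> with \<open>j \<noteq> i\<close>. The
  intersection property follows once every \<open>\<langle>\<rho> j : j \<in> J\<rangle>\<close> is the intersection of the \<open>M i\<close> with
  \<open>i \<notin> J\<close>.

  If \<open>0 \<in> J\<close> and \<open>c\<close> is the least index missing from \<open>J\<close>, then \<open>M c\<close> is the commuting product of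
  \<open>\<langle>\<rho> j : j < c\<rangle>\<close> and \<open>\<langle>\<rho> j : j > c\<rangle>\<close>, so only the group \<open>\<langle>\<rho> 2, \<dots>, \<rho> 5\<rangle>\<close> matters. It acts on the
  eleven points \<open>x_L, a, \<dots>, m\<close> as the group of the 11-cell, PSL(2,11), in which the
  subgroups in question are stabilisers of small blocks; this is a finite check by Schreier's lemma.

  If \<open>0 \<notin> J\<close> and \<open>1 \<in> J\<close>, let \<open>\<sigma>\<close> be \<open>\<rho> 1\<close> without the transposition \<open>(x_{L-1} x_L)\<close>; it is odd as
  \<open>n \<equiv> 3\<close> modulo 4. Conjugating \<open>\<rho> 1\<close> by words in \<open>\<rho> 2, \<dots>, \<rho> 5\<close> yields \<open>\<sigma>\<close> times the transpositions of
  \<open>x_{L-1}\<close> with the points \<open>y\<close> of the orbit of \<open>x_L\<close>. Hence every permutation of that orbit together with \<open>x_{L-1}\<close>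
  is realised up to a factor \<open>\<sigma>\<close>, and since all \<open>\<rho> j\<close> are even, parity tells
  when that factor is present. The same elements give enough 3-cycles to generate \<open>A_n\<close>.
\<close>

section \<open>Groups of permutations generated by involutions\<close>

text \<open>No inverses are needed because all \<open>r j\<close> of interest are involutions.\<close>

inductive_set gp :: "(nat \<Rightarrow> 'a \<Rightarrow> 'a) \<Rightarrow> nat set \<Rightarrow> ('a \<Rightarrow> 'a) set" for r J where
  gp_id: "id \<in> gp r J"
| gp_step: "j \<in> J \<Longrightarrow> p \<in> gp r J \<Longrightarrow> r j \<circ> p \<in> gp r J"

lemma gp_gen: "j \<in> J \<Longrightarrow> r j \<in> gp r J"
  using gp_step[OF _ gp_id] by fastforce

lemma gp_comp: "p \<in> gp r J \<Longrightarrow> q \<in> gp r J \<Longrightarrow> p \<circ> q \<in> gp r J"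
  by (induction rule: gp.induct) (auto simp: comp_assoc intro: gp_step)

lemma gp_mono: "p \<in> gp r J \<Longrightarrow> J \<subseteq> K \<Longrightarrow> p \<in> gp r K"
  by (induction rule: gp.induct) (auto intro: gp.intros)

lemma gp_closed:
  assumes "p \<in> gp r J" "\<And>j v. j \<in> J \<Longrightarrow> v \<in> S \<Longrightarrow> r j v \<in> S" "v \<in> S"
  shows "p v \<in> S"
  using assms by (induction rule: gp.induct) auto

lemma gp_fixes:
  assumes "p \<in> gp r J" "\<And>j. j \<in> J \<Longrightarrow> r j v = v"
  shows "p v = v"
  using gp_closed[of p r J "{v}"] assms by auto

lemma gp_permutes:
  assumes "p \<in> gp r J" "\<And>j. j \<in> J \<Longrightarrow> r j permutes S"
  shows "p permutes S"
  using assms by (induction rule: gp.induct) (auto intro: permutes_compose permutes_id)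

lemma gp_evenperm:
  assumes "p \<in> gp r J" "\<And>j. j \<in> J \<Longrightarrow> permutation (r j) \<and> evenperm (r j)"
  shows "permutation p \<and> evenperm p"
  using assms by (induction rule: gp.induct) (auto simp: evenperm_comp intro: permutation_compose)

lemma gp_commute:
  assumes "p \<in> gp r J" "\<And>j. j \<in> J \<Longrightarrow> r j \<circ> q = q \<circ> r j"
  shows "p \<circ> q = q \<circ> p"
  using assms by (induction rule: gp.induct) (auto simp: fun_eq_iff)

text \<open>Letters from \<open>B\<close> are moved to the right past the \<open>A\<close>-part
  collected so far, with which they commute.\<close>

lemma gp_union_split:
  assumes "p \<in> gp r (A \<union> B)" "\<And>a b. a \<in> A \<Longrightarrow> b \<in> B \<Longrightarrow> r a \<circ> r b = r b \<circ> r a"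
  obtains y z where "y \<in> gp r A" "z \<in> gp r B" "p = y \<circ> z"
  using assms(1)
proof (induction arbitrary: thesis rule: gp.induct)
  case gp_id
  show ?case by (rule gp_id[OF gp.gp_id gp.gp_id]) simp
next
  case (gp_step j p)
  obtain y z where yz: "y \<in> gp r A" "z \<in> gp r B" "p = y \<circ> z"
    using gp_step.IH by blast
  show ?case
  proof (cases "j \<in> A")
    case True
    then show ?thesis
      using gp_step.prems[OF gp.gp_step yz(2)] yz(1,3) by (simp only: comp_assoc)
  next
    case False
    then have j: "j \<in> B" using gp_step.hyps by auto
    have "y \<circ> r j = r j \<circ> y"
      using gp_commute[OF yz(1)] assms(2) j by metis
    then have "r j \<circ> p = y \<circ> (r j \<circ> z)"
      by (metis comp_assoc yz(3))
    then show ?thesis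
      using gp_step.prems[OF yz(1) gp.gp_step] yz(2) j by blast
  qed
qed

text \<open>The inverse is the reversed word, each letter being its own inverse.\<close>

lemma gp_inverse:
  assumes "p \<in> gp r J" "\<And>j. j \<in> J \<Longrightarrow> r j \<circ> r j = id"
  obtains q where "q \<in> gp r J" "q \<circ> p = id" "p \<circ> q = id"
  using assms(1)
proof (induction arbitrary: thesis rule: gp.induct)
  case gp_id
  show ?case by (rule gp_id[OF gp.gp_id]) simp_all
next
  case (gp_step j p)
  obtain q where q: "q \<in> gp r J" "q \<circ> p = id" "p \<circ> q = id"
    using gp_step.IH by blast
  have j: "r j \<circ> r j = id" using assms(2) gp_step.hyps by blast
  have "(q \<circ> r j) \<circ> (r j \<circ> p) = q \<circ> (r j \<circ> r j) \<circ> p" "(r j \<circ> p) \<circ> (q \<circ> r j) = r j \<circ> (p \<circ> q) \<circ> r j"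
    by (simp_all add: comp_assoc)
  then show ?case
    using gp_step.prems[OF gp_comp[OF q(1) gp_gen]] gp_step.hyps q j by (metis comp_id)
qed

text \<open>Links words to the generated subgroups of the abstract group. An involution is its own
  inverse, so the inverse rule of \<open>generate\<close> yields only generators again.\<close>

lemma generate_eq_gp:
  assumes "group G" "mult G = (\<circ>)" "one G = id" "r ` J \<subseteq> carrier G"
    and inv: "\<And>j. j \<in> J \<Longrightarrow> r j \<circ> r j = id"
  shows "generate G (r ` J) = gp r J"
proof
  interpret group G by fact
  have "p \<in> gp r J" if "p \<in> generate G (r ` J)" for p
    using that
  proof (induction rule: generate.induct)
    case one
    then show ?case unfolding assms(3) by (rule gp_id)
  next
    case (incl h)
    then show ?case by (auto intro: gp_gen)
  next
    case (inv h)
    then obtain j where j: "j \<in> J" "h = r j" by auto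
    then have "inv\<^bsub>G\<^esub> h = h"
      using inv_equality[of h h] assms(2-4) assms(5)[OF j(1)] by auto
    then show ?case using j by (simp add: gp_gen)
  next
    case (eng h1 h2)
    then show ?case unfolding assms(2) by (blast intro: gp_comp)
  qed
  then show "generate G (r ` J) \<subseteq> gp r J" by blast
  have "p \<in> generate G (r ` J)" if "p \<in> gp r J" for p
    using that
  proof (induction rule: gp.induct)
    case gp_id
    then show ?case using generate.one[of G "r ` J"] assms(3) by metis
  next
    case (gp_step j p)
    then show ?case
      using generate.eng[of "r j" G "r ` J" p] generate.incl[of "r j" "r ` J" G] assms(2)
      by (metis imageI)
  qed
  then show "gp r J \<subseteq> generate G (r ` J)" by blast
qed

lemma perm_group_is_group: "group (perm_group S)"
  by (intro groupI)
     (auto simp: perm_group_def comp_assoc intro: permutes_compose permutes_id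
           dest: permutes_inv permutes_inv_o(2))

lemma pow_eq_funpow:
  assumes "mult G = (\<circ>)" "one G = id"
  shows "f [^]\<^bsub>G\<^esub> (k::nat) = f ^^ k"
proof (induction k)
  case 0
  then show ?case by (simp add: assms nat_pow_def)
next
  case (Suc k)
  then show ?case by (simp add: assms nat_pow_def funpow_swap1 fun_eq_iff)
qed

text \<open>The factor \<open>\<tau>\<close> marks odd permutations. The transpositions through
  \<open>z\<close> generate all others, and two copies of \<open>\<tau>\<close> cancel whenever they
  meet. With \<open>\<sigma>\<close> as \<open>\<tau>\<close> this describes the subgroups
  containing \<open>\<rho> 1\<close>. With \<open>(a b)\<close> as \<open>\<tau>\<close> and
  \<open>a\<close> as \<open>z\<close>, the products in \<open>star\<close> are 3-cycles or the
  identity, which yields the full group.\<close>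

lemma star_transpositions_generate:
  assumes K: "id \<in> K" "\<And>p q. p \<in> K \<Longrightarrow> q \<in> K \<Longrightarrow> p \<circ> q \<in> K" and \<tau>: "\<tau> \<circ> \<tau> = id"
    and star: "\<And>y. y \<in> Y \<Longrightarrow> y \<noteq> z \<Longrightarrow> \<tau> \<circ> transpose z y \<in> K \<and> transpose z y \<circ> \<tau> \<in> K"
    and "finite Y" and "p permutes insert z Y"
  shows "(if evenperm p then p else \<tau> \<circ> p) \<in> K"
proof -
  have \<tau>': "\<tau> (\<tau> v) = v" for v using \<tau> by (metis comp_apply id_apply)
  have tp: "\<tau> \<circ> transpose a b \<in> K \<and> transpose a b \<circ> \<tau> \<in> K"
    if ab: "a \<in> insert z Y" "b \<in> insert z Y" "a \<noteq> b" for a b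
  proof (cases "a = z \<or> b = z")
    case True
    then show ?thesis using ab star by (metis insertE transpose_commute)
  next
    case False
    let ?s = "transpose z"
    have eq: "transpose a b = ?s a \<circ> ?s b \<circ> ?s a"
      using False ab by (auto simp: fun_eq_iff transpose_def)
    have "\<tau> \<circ> transpose a b = (\<tau> \<circ> ?s a) \<circ> (?s b \<circ> \<tau>) \<circ> (\<tau> \<circ> ?s a)"
      "transpose a b \<circ> \<tau> = (?s a \<circ> \<tau>) \<circ> (\<tau> \<circ> ?s b) \<circ> (?s a \<circ> \<tau>)"
      by (auto simp: eq fun_eq_iff \<tau>')
    then show ?thesis using K(2) star False ab by auto
  qed
  have "finite (insert z Y)" using assms by auto
  with \<open>p permutes insert z Y\<close> show ?thesis
  proof (induction p rule: permutes_induct)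
    case id
    show ?case using K(1) by (simp del: id_apply)
  next
    case (swap a b p)
    have p: "permutation p" using swap.hyps \<open>finite Y\<close> permutation_permutes by blast
    have ev: "evenperm (transpose a b \<circ> p) \<longleftrightarrow> \<not> evenperm p"
      using evenperm_comp[OF permutation_swap_id p] evenperm_swap swap.hyps by metis
    show ?case
    proof (cases "evenperm p")
      case True
      then have "(\<tau> \<circ> transpose a b) \<circ> p \<in> K"
        using K(2) \<open>a \<noteq> b\<close> swap by (metis tp)
      then show ?thesis using ev True by (simp add: comp_assoc del: comp_apply)
    next
      case False
      then have "(transpose a b \<circ> \<tau>) \<circ> (\<tau> \<circ> p) \<in> K"
        using K(2) \<open>a \<noteq> b\<close> swap by (metis tp)
      moreover have "(transpose a b \<circ> \<tau>) \<circ> (\<tau> \<circ> p) = transpose a b \<circ> p"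
        by (auto simp: fun_eq_iff \<tau>')
      ultimately show ?thesis using ev False by (simp del: comp_apply)
    qed
  qed
qed

section \<open>The generators as explicit functions\<close>

text \<open>The product of the \<open>k\<close> transpositions \<open>(x_{c+1} x_{c+2}), (x_{c+3} x_{c+4}), \<dots>\<close>\<close>

definition swaps :: "nat \<Rightarrow> nat \<Rightarrow> vert \<Rightarrow> vert" where
  "swaps c k v = (case v of X i \<Rightarrow>
      X (if c < i \<and> i \<le> c + 2 * k then if odd (i - c) then i + 1 else i - 1 else i) | _ \<Rightarrow> v)"

lemma swaps_simps [simp]:
  "swaps c k Va = Va" "swaps c k Vb = Vb" "swaps c k Vc = Vc" "swaps c k Vd = Vd"
  "swaps c k Ve = Ve" "swaps c k Vf = Vf" "swaps c k Vg = Vg" "swaps c k Vh = Vh"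
  "swaps c k Vk = Vk" "swaps c k Vm = Vm"
  by (simp_all add: swaps_def)

lemma swaps_X: "swaps c k (X i) = 
      X (if c < i \<and> i \<le> c + 2 * k then if odd (i - c) then i + 1 else i - 1 else i)"
  by (simp add: swaps_def)

lemma swaps_Suc:
  "swaps c (Suc k) = transpose (X (c + 2 * k + 1)) (X (c + 2 * k + 2)) \<circ> swaps c k"
proof
  fix v
  show "swaps c (Suc k) v = (transpose (X (c + 2 * k + 1)) (X (c + 2 * k + 2)) \<circ> swaps c k) v"
  proof (cases v)
    case (X i)
    consider "i \<le> c" | "c < i" "i \<le> c + 2 * k" | "i = c + 2 * k + 1" | "i = c + 2 * k + 2" | "i > c + 2 * k + 2"
      by linarith
    then show ?thesis
    proof cases
      case 2
      then have "odd (i - c) \<Longrightarrow> i \<noteq> c + 2 * k" by auto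
      then show ?thesis using X 2 by (auto simp: swaps_X transpose_def)
    qed (use X in \<open>auto simp: swaps_X transpose_def\<close>)
  qed (auto simp: transpose_def)
qed

lemma swaps_0: "swaps c 0 = id"
  by (auto simp: fun_eq_iff swaps_def split: vert.splits)

lemma swaps_parity: "permutation (swaps c k) \<and> (evenperm (swaps c k) \<longleftrightarrow> even k)"
proof (induction k)
  case 0
  show ?case unfolding swaps_0 by simp
next
  case (Suc k)
  then show ?case
    unfolding swaps_Suc by (simp add: evenperm_comp permutation_compose permutation_swap_id evenperm_swap del: comp_apply)
qed

lemma swaps_involution: "swaps c k (swaps c k v) = v"
proof (cases v)
  case (X i)
  show ?thesis
  proof (cases "c < i \<and> i \<le> c + 2 * k")
    case True
    show ?thesis
    proof (cases "odd (i - c)")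
      case o: True
      then have "i \<noteq> c + 2 * k" by auto
      then show ?thesis using X True o by (auto simp: swaps_X Suc_diff_le)
    next
      case o: False
      then have "i \<noteq> c + 1" "odd (i - 1 - c)" using True by auto
      then show ?thesis using X True o by (auto simp: swaps_X)
    qed
  qed (use X in \<open>auto simp: swaps_X\<close>)
qed auto

text \<open>
  The generators \<open>\<rho> 2, \<dots>, \<rho> 5\<close> on the eleven points they move, where \<open>X 0\<close> stands for \<open>x_L\<close>, so that
  they can be evaluated without knowing \<open>L\<close>.
\<close>

datatype gen = R2 | R3 | R4 | R5

fun act :: "gen \<Rightarrow> vert \<Rightarrow> vert" where
  "act R2 v = (case v of X _ \<Rightarrow> Va | Va \<Rightarrow> X 0 | Ve \<Rightarrow> Vh | Vh \<Rightarrow> Ve | Vf \<Rightarrow> Vk | Vk \<Rightarrow> Vf | Vg \<Rightarrow> Vm | Vm \<Rightarrow> Vg | _ \<Rightarrow> v)"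
| "act R3 v = (case v of Va \<Rightarrow> Vb | Vb \<Rightarrow> Va | Vc \<Rightarrow> Ve | Ve \<Rightarrow> Vc | Vd \<Rightarrow> Vf | Vf \<Rightarrow> Vd | Vg \<Rightarrow> Vm | Vm \<Rightarrow> Vg | _ \<Rightarrow> v)"
| "act R4 v = (case v of Vb \<Rightarrow> Vc | Vc \<Rightarrow> Vb | Vf \<Rightarrow> Vg | Vg \<Rightarrow> Vf | Vk \<Rightarrow> Vm | Vm \<Rightarrow> Vk | Vh \<Rightarrow> Ve | Ve \<Rightarrow> Vh | _ \<Rightarrow> v)"
| "act R5 v = (case v of Vc \<Rightarrow> Vd | Vd \<Rightarrow> Vc | Ve \<Rightarrow> Vf | Vf \<Rightarrow> Ve | Vh \<Rightarrow> Vk | Vk \<Rightarrow> Vh | Vg \<Rightarrow> Vm | Vm \<Rightarrow> Vg | _ \<Rightarrow> v)"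

primrec label :: "gen \<Rightarrow> nat" where
  "label R2 = 2" | "label R3 = 3" | "label R4 = 4" | "label R5 = 5"

text \<open>All \<open>X i\<close> are sent to \<open>x_L\<close> because \<open>act\<close> treats
  every \<open>X i\<close> as the one point \<open>X 0\<close>. Hence \<open>emb L\<close> carries
  \<open>act\<close> to the true generators without conditions on indices.\<close>

definition emb :: "nat \<Rightarrow> vert \<Rightarrow> vert" where
  "emb L v = (case v of X _ \<Rightarrow> X L | _ \<Rightarrow> v)"

definition lift :: "nat \<Rightarrow> gen \<Rightarrow> vert \<Rightarrow> vert" where
  "lift L a v = (if \<exists>i. v = X i \<and> i \<noteq> L then v else emb L (act a v))"

section \<open>The permutations read off from the edges\<close>

lemma lg_perm_eqI:
  assumes "\<And>v w. v \<noteq> w \<Longrightarrow> ({v, w}, k) \<in> E \<longleftrightarrow> f v = w"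
  shows "lg_perm E k = f"
proof
  fix v
  show "lg_perm E k v = f v"
  proof (cases "f v = v")
    case True
    then have "\<nexists>w. w \<noteq> v \<and> ({v, w}, k) \<in> E" using assms by metis
    then show ?thesis using True unfolding lg_perm_def by auto
  next
    case False
    then have ex: "f v \<noteq> v \<and> ({v, f v}, k) \<in> E" using assms by metis
    then have "(THE w. w \<noteq> v \<and> ({v, w}, k) \<in> E) = f v"
      using assms by (intro the_equality) metis+
    then show ?thesis using ex unfolding lg_perm_def by auto
  qed
qed

locale graph413 =
  fixes n L :: nat
  assumes n_eq: "n = L + 10" and L5: "L \<ge> 5" and L_mod: "L mod 4 = 1"
begin

abbreviation "\<rho> \<equiv> rho413 n"
abbreviation "V \<equiv> verts413 n"

lemma L_odd: "odd L"
  using L_mod by presburger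

lemma L_half [simp]: "2 * ((L - Suc 0) div 2) = L - Suc 0"
  using L_odd by simp

text \<open>Labels are counted back from the end of the path. As \<open>L\<close> is odd, this gives
  label 0 to the edges \<open>{x_s, x_{s+1}}\<close> with \<open>s\<close> odd and label 1 to those
  with \<open>s\<close> even.\<close>

lemma path_edge_iff:
  "({v, w}, k) \<in> alt_path_edges (map X [1..<n - 9]) \<longleftrightarrow>
     (\<exists>s. 1 \<le> s \<and> s < L \<and> ({v, w} = {X s, X (s + 1)}) \<and> k = (if odd s then 0 else 1))"
proof -
  have "(\<exists>s. 1 \<le> s \<and> s \<le> L - 1 \<and> {v, w} = {map X [1..<L+1] ! (s - 1), map X [1..<L+1] ! s} \<and> k = (if odd (L - s) then 1 else 0)) \<longleftrightarrow>
     (\<exists>s. 1 \<le> s \<and> s < L \<and> ({v, w} = {X s, X (s + 1)}) \<and> k = (if odd s then 0 else 1))"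
  proof (intro ex_cong1)
    fix s
    show "(1 \<le> s \<and> s \<le> L - 1 \<and> {v, w} = {map X [1..<L+1] ! (s - 1), map X [1..<L+1] ! s} \<and> k = (if odd (L - s) then 1 else 0)) \<longleftrightarrow>
       (1 \<le> s \<and> s < L \<and> ({v, w} = {X s, X (s + 1)}) \<and> k = (if odd s then 0 else 1))"
    proof (cases "1 \<le> s \<and> s < L")
      case True
      then have "s - 1 < L + 1 - 1" "s < L + 1 - 1" "1 + (s - 1) = s" by linarith+
      then have "map X [1..<L+1] ! (s - 1) = X s" "map X [1..<L+1] ! s = X (s + 1)"
        by (simp_all only: nth_map_upt add.commute)
      moreover have "odd (L - s) \<longleftrightarrow> even s" using True L_odd by auto
      moreover have "s \<le> L - 1" using True by linarith
      ultimately show ?thesis using True by (simp del: upt_Suc One_nat_def add: add.commute)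
    next
      case False
      then have "\<not> (1 \<le> s \<and> s \<le> L - 1)" using L5 by linarith
      then show ?thesis using False by blast
    qed
  qed
  moreover have "n - 9 = L + 1" "length (map X [1..<L + 1]) = L" using n_eq by auto
  ultimately show ?thesis
    unfolding alt_path_edges_def mem_Collect_eq prod.inject by metis
qed

lemma edges_path:
  "(e, 0) \<in> edges413 n \<longleftrightarrow> (e, 0) \<in> alt_path_edges (map X [1..<n - 9])"
  "(e, 1) \<in> edges413 n \<longleftrightarrow> (e, 1) \<in> alt_path_edges (map X [1..<n - 9])"
  unfolding edges413_def by simp_all

lemma edge0_iff:
  assumes "v \<noteq> w"
  shows "({v, w}, 0) \<in> edges413 n \<longleftrightarrow> swaps 0 ((L - 1) div 2) v = w"
proof -
  have "({v, w}, 0) \<in> edges413 n \<longleftrightarrow> (\<exists>s. 1 \<le> s \<and> s < L \<and> ({v, w} = {X s, X (s + 1)}) \<and> odd s)"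
    unfolding edges_path path_edge_iff by (rule ex_cong1) simp
  also have "\<dots> \<longleftrightarrow> swaps 0 ((L - 1) div 2) v = w"
  proof
    assume "\<exists>s. 1 \<le> s \<and> s < L \<and> ({v, w} = {X s, X (s + 1)}) \<and> odd s"
    then obtain s where s: "1 \<le> s" "s < L" "{v, w} = {X s, X (s + 1)}" "odd s" by blast
    \<comment> \<open>\<open>L - 1\<close> is even, so an odd \<open>s\<close> leaves room for its
      partner \<open>s + 1\<close> among the first \<open>L - 1\<close> points; \<open>x_L\<close>
      is fixed by \<open>\<rho> 0\<close>.\<close>
    have "s \<noteq> L - 1" using s(4) L_odd by auto
    then have "s + 1 \<le> L - 1" using s by linarith
    then show "swaps 0 ((L - 1) div 2) v = w"
      using s(1,2,4) s(3)[unfolded doubleton_eq_iff] by (auto simp: swaps_X)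
  next
    assume w: "swaps 0 ((L - 1) div 2) v = w"
    then obtain i where i: "v = X i" using assms by (cases v) auto
    then have i': "0 < i" "i \<le> L - 1" "w = X (if odd i then i + 1 else i - 1)"
      using w assms by (auto simp: swaps_X split: if_splits)
    show "\<exists>s. 1 \<le> s \<and> s < L \<and> ({v, w} = {X s, X (s + 1)}) \<and> odd s"
    proof (cases "odd i")
      case True
      then have "{v, w} = {X i, X (i + 1)}" "1 \<le> i" "i < L"
        using i i' by auto
      then show ?thesis using True by blast
    next
      case False
      then have "{v, w} = {X (i - 1), X (i - 1 + 1)}" "1 \<le> i - 1" "i - 1 < L" "odd (i - 1)"
        using i i' by (auto simp: doubleton_eq_iff)
      then show ?thesis by blast
    qed
  qed
  finally show "({v, w}, 0) \<in> edges413 n \<longleftrightarrow> swaps 0 ((L - 1) div 2) v = w" .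
qed

lemma rho0: "\<rho> 0 = swaps 0 ((L - 1) div 2)"
  unfolding rho413_def by (intro lg_perm_eqI edge0_iff)

lemma edge1_iff:
  assumes "v \<noteq> w"
  shows "({v, w}, 1) \<in> edges413 n \<longleftrightarrow> swaps 1 ((L - 1) div 2) v = w"
proof -
  have "({v, w}, 1) \<in> edges413 n \<longleftrightarrow> (\<exists>s. 1 \<le> s \<and> s < L \<and> ({v, w} = {X s, X (s + 1)}) \<and> even s)"
    unfolding edges_path path_edge_iff
    by (rule ex_cong1) simp
  also have "\<dots> \<longleftrightarrow> swaps 1 ((L - 1) div 2) v = w"
  proof
    assume "\<exists>s. 1 \<le> s \<and> s < L \<and> ({v, w} = {X s, X (s + 1)}) \<and> even s"
    then obtain s where s: "1 \<le> s" "s < L" "{v, w} = {X s, X (s + 1)}" "even s" by blast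
    have "1 < s" using s(1,4) by (metis le_neq_implies_less odd_one)
    then show "swaps 1 ((L - 1) div 2) v = w"
      using s(1,2,4) s(3)[unfolded doubleton_eq_iff] by (auto simp: swaps_X)
  next
    assume w: "swaps 1 ((L - 1) div 2) v = w"
    then obtain i where i: "v = X i" using assms by (cases v) auto
    then have i': "1 < i" "i \<le> L" "w = X (if even i then i + 1 else i - 1)"
      using w assms L5 by (auto simp: swaps_X split: if_splits)
    show "\<exists>s. 1 \<le> s \<and> s < L \<and> ({v, w} = {X s, X (s + 1)}) \<and> even s"
    proof (cases "even i")
      case True
      then have "i < L" using i' L_odd by (metis le_neq_implies_less)
      moreover have "{v, w} = {X i, X (i + 1)}" "1 \<le> i"
        using i i' True by auto
      ultimately show ?thesis using True by blast
    next
      case False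
      then have "{v, w} = {X (i - 1), X (i - 1 + 1)}" "1 \<le> i - 1" "i - 1 < L" "even (i - 1)"
        using i i' by (auto simp: doubleton_eq_iff)
      then show ?thesis by blast
    qed
  qed
  finally show "({v, w}, 1) \<in> edges413 n \<longleftrightarrow> swaps 1 ((L - 1) div 2) v = w" .
qed

lemma rho1: "\<rho> 1 = swaps 1 ((L - 1) div 2)"
  unfolding rho413_def by (intro lg_perm_eqI edge1_iff)

lemma path_label: "(e, label a) \<notin> alt_path_edges xs"
  by (cases a) (auto simp: alt_path_edges_def)

lemma edges_label:
  "(e, label a) \<in> edges413 n \<longleftrightarrow> e \<in> (case a of
      R2 \<Rightarrow> {{X L, Va}, {Vh, Ve}, {Vk, Vf}, {Vm, Vg}}
    | R3 \<Rightarrow> {{Va, Vb}, {Vc, Ve}, {Vd, Vf}, {Vm, Vg}}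
    | R4 \<Rightarrow> {{Vb, Vc}, {Vf, Vg}, {Vk, Vm}, {Vh, Ve}}
    | R5 \<Rightarrow> {{Vc, Vd}, {Ve, Vf}, {Vh, Vk}, {Vm, Vg}})"
  using path_label[of e a] by (cases a) (simp_all add: edges413_def n_eq)

lemma edge_label_iff:
  assumes "v \<noteq> w"
  shows "({v, w}, label a) \<in> edges413 n \<longleftrightarrow> lift L a v = w"
  unfolding edges_label using assms
  by (cases a; cases v) (auto simp: lift_def emb_def doubleton_eq_iff)

lemma rho_label: "\<rho> (label a) = lift L a"
  unfolding rho413_def by (intro lg_perm_eqI edge_label_iff)

end

section \<open>A verified Schreier check\<close>

text \<open>
  An element of \<open>\<langle>B\<rangle>\<close> is identified by the images of all points, a coset of the stabiliser of the
  set \<open>\<omega>\<close> by the image of that set. Nothing is proved about the breadth-first search for coset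
  representatives and elements of \<open>\<langle>B\<rangle>\<close>: \<open>schreier_ok\<close> validates whatever lists it is given.
  All functions are first order since \<open>code_simp\<close> also rewrites under abstractions.
\<close>

definition pts :: "vert list" where
  "pts = [X 0, Va, Vb, Vc, Vd, Ve, Vf, Vg, Vh, Vk, Vm]"

primrec ev :: "gen list \<Rightarrow> vert \<Rightarrow> vert" where
  "ev [] v = v"
| "ev (a # w) v = act a (ev w v)"

text \<open>Listing a set in the fixed order of the first argument turns equality of sets into
  equality of lists.\<close>

primrec select :: "vert list \<Rightarrow> vert list \<Rightarrow> vert list" where
  "select [] s = []"
| "select (p # ps) s = (if p \<in> set s then p # select ps s else select ps s)"

fun key :: "vert list option \<Rightarrow> gen list \<Rightarrow> vert list" where
  "key None w = map (ev w) pts"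
| "key (Some \<omega>) w = select pts (map (ev w) \<omega>)"

definition add_new :: "'k \<Rightarrow> 'w \<Rightarrow> ('k \<times> 'w) list \<Rightarrow> ('k \<times> 'w) list \<Rightarrow> ('k \<times> 'w) list" where
  "add_new k w acc new = (case map_of acc k of Some _ \<Rightarrow> new | None \<Rightarrow>
     (case map_of new k of Some _ \<Rightarrow> new | None \<Rightarrow> (k, w) # new))"

primrec extend where
  "extend \<omega> [] w acc new = new"
| "extend \<omega> (a # as) w acc new = extend \<omega> as w acc (add_new (key \<omega> (a # w)) (a # w) acc new)"

primrec layer where
  "layer \<omega> gs [] acc new = new"
| "layer \<omega> gs (x # xs) acc new = layer \<omega> gs xs acc (extend \<omega> gs (snd x) acc new)"

text \<open>The function \<open>step\<close> acts as a \<open>let\<close>: it binds the new layer,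
  which is used twice on its right-hand side.\<close>

fun bfs and step where
  "bfs \<omega> gs 0 fr acc = acc"
| "bfs \<omega> gs (Suc d) fr acc = step \<omega> gs d (layer \<omega> gs fr acc []) acc"
| "step \<omega> gs d new acc = bfs \<omega> gs d new (new @ acc)"

definition orbit_words :: "nat \<Rightarrow> vert list option \<Rightarrow> gen list \<Rightarrow> (vert list \<times> gen list) list" where
  "orbit_words d \<omega> gs = bfs \<omega> gs d [(key \<omega> [], [])] [(key \<omega> [], [])]"

text \<open>The candidate word \<open>w\<close> found in \<open>W\<close> is tested again against
  \<open>s\<close>, so a positive answer can be trusted whatever \<open>W\<close> contains.\<close>

definition in_sub where
  "in_sub B W s = (case map_of W (key None s) of None \<Rightarrow> False
     | Some w \<Rightarrow> set w \<subseteq> set B \<and> key None s = key None w)"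

text \<open>Forms the Schreier generator: with \<open>t\<close> the representative of the coset of
  \<open>s\<close>, the word \<open>rev t @ s\<close> stands for the inverse of \<open>t\<close>
  times \<open>s\<close>. A failed lookup rejects, so a passing check also shows that the cosets
  listed in \<open>T\<close> are closed under the generators.\<close>

definition schreier_gen where
  "schreier_gen \<omega> B T W s = (case map_of T (key (Some \<omega>) s) of None \<Rightarrow> False
     | Some t \<Rightarrow> in_sub B W (rev t @ s))"

primrec schreier_row where
  "schreier_row \<omega> B T W t [] = True"
| "schreier_row \<omega> B T W t (a # as) = (schreier_gen \<omega> B T W (a # t) \<and> schreier_row \<omega> B T W t as)"

primrec schreier_all where
  "schreier_all \<omega> A B T W [] = True"
| "schreier_all \<omega> A B T W (x # xs) = (schreier_row \<omega> B T W (snd x) A \<and> schreier_all \<omega> A B T W xs)"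

primrec keeps :: "vert list \<Rightarrow> gen list \<Rightarrow> bool" where
  "keeps \<omega> [] = True"
| "keeps \<omega> (b # bs) = (key (Some \<omega>) [b] = key (Some \<omega>) [] \<and> keeps \<omega> bs)"

definition schreier_ok where
  "schreier_ok \<omega> A B T W \<longleftrightarrow>
     map_of T (key (Some \<omega>) []) = Some [] \<and> keeps \<omega> B \<and> schreier_all \<omega> A B T W T"

text \<open>The bound 10 only limits the lengths of the words searched. Too small a bound would make
  a lookup fail and could not validate a false claim.\<close>

definition schreier_check :: "vert list \<Rightarrow> gen list \<Rightarrow> gen list \<Rightarrow> bool" where
  "schreier_check \<omega> A B = schreier_ok \<omega> A B (orbit_words 10 (Some \<omega>) A) (orbit_words 10 None B)"

section \<open>Soundness of the check\<close>

lemma pts_set: "set pts = {X 0, Va, Vb, Vc, Vd, Ve, Vf, Vg, Vh, Vk, Vm}"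
  by (simp add: pts_def)

lemma act_pts: "v \<in> set pts \<Longrightarrow> act a v \<in> set pts \<and> act a (act a v) = v"
  by (cases a) (auto simp: pts_set)

lemma ev_append: "ev (u @ w) v = ev u (ev w v)"
  by (induction u) auto

lemma ev_pts: "v \<in> set pts \<Longrightarrow> ev w v \<in> set pts"
  by (induction w) (auto simp: act_pts)

lemma ev_rev: "v \<in> set pts \<Longrightarrow> ev (rev w) (ev w v) = v"
  by (induction w) (auto simp: ev_append act_pts ev_pts)

lemma select_cong: "set s = set s' \<Longrightarrow> select ps s = select ps s'"
  by (induction ps) auto

lemma set_select: "set (select ps s) = set ps \<inter> set s"
  by (induction ps) auto

lemma key_Some_eq_iff:
  assumes "set \<omega> \<subseteq> set pts"
  shows "key (Some \<omega>) u = key (Some \<omega>) w \<longleftrightarrow> ev u ` set \<omega> = ev w ` set \<omega>"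
proof
  assume "key (Some \<omega>) u = key (Some \<omega>) w"
  then have "set pts \<inter> ev u ` set \<omega> = set pts \<inter> ev w ` set \<omega>"
    using set_select[of pts "map (ev u) \<omega>"] set_select[of pts "map (ev w) \<omega>"] by simp
  moreover have "ev x ` set \<omega> \<subseteq> set pts" for x using assms ev_pts by auto
  ultimately show "ev u ` set \<omega> = ev w ` set \<omega>" by (metis Int_absorb1)
qed (auto intro: select_cong)

lemma in_subD:
  assumes "in_sub B W s"
  obtains w where "set w \<subseteq> set B" "\<And>v. v \<in> set pts \<Longrightarrow> ev s v = ev w v"
  using assms by (auto simp: in_sub_def split: option.splits)

lemma schreier_rowD: "schreier_row \<omega> B T W t as \<Longrightarrow> a \<in> set as \<Longrightarrow> schreier_gen \<omega> B T W (a # t)"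
  by (induction as) auto

lemma schreier_allD:
  "schreier_all \<omega> A B T W xs \<Longrightarrow> x \<in> set xs \<Longrightarrow> a \<in> set A \<Longrightarrow> schreier_gen \<omega> B T W (a # snd x)"
  by (induction xs) (auto dest: schreier_rowD)

lemma keepsD:
  assumes "keeps \<omega> B" "set \<omega> \<subseteq> set pts" "set w \<subseteq> set B"
  shows "ev w ` set \<omega> = set \<omega>"
proof -
  have "act b ` set \<omega> = set \<omega>" if "b \<in> set B" for b
    using assms(1) that
  proof (induction B)
    case (Cons b' B)
    then show ?case using key_Some_eq_iff[OF assms(2), of "[b']" "[]"] by auto
  qed simp
  with assms(3) show ?thesis
  proof (induction w)
    case (Cons b w)
    have "ev (b # w) ` set \<omega> = act b ` ev w ` set \<omega>" by (simp add: image_image)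
    then show ?case using Cons by simp
  qed simp
qed

text \<open>Schreier's lemma, by induction on the word: \<open>s\<close> factors as a representative
  \<open>t\<close> times a word \<open>w\<close> over \<open>B\<close>. Prepending \<open>a\<close>
  turns \<open>a t\<close> into \<open>t'\<close> times the Schreier generator of
  \<open>a t\<close>, which the check has placed in the subgroup of \<open>B\<close>. If
  \<open>s\<close> preserves the block, its representative is the empty word.\<close>

lemma schreier:
  assumes ok: "schreier_ok \<omega> A B T W" and \<omega>: "set \<omega> \<subseteq> set pts"
    and s: "set s \<subseteq> set A" "ev s ` set \<omega> = set \<omega>"
  obtains w where "set w \<subseteq> set B" "\<And>v. v \<in> set pts \<Longrightarrow> ev s v = ev w v"
proof -
  have "\<exists>t w. map_of T (key (Some \<omega>) s) = Some t \<and> set w \<subseteq> set B \<and> (\<forall>v\<in>set pts. ev s v = ev t (ev w v))"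
    using s(1)
  proof (induction s)
    case Nil
    then show ?case using ok by (intro exI[of _ "[]"]) (auto simp: schreier_ok_def simp del: key.simps)
  next
    case (Cons a s)
    then obtain t w where tw: "map_of T (key (Some \<omega>) s) = Some t" "set w \<subseteq> set B"
      "\<forall>v\<in>set pts. ev s v = ev t (ev w v)" by auto
    have "schreier_gen \<omega> B T W (a # t)"
      using schreier_allD[of \<omega> A B T W T "(key (Some \<omega>) s, t)" a] ok map_of_SomeD[OF tw(1)] Cons.prems
      by (auto simp: schreier_ok_def)
    then obtain t' where t': "map_of T (key (Some \<omega>) (a # t)) = Some t'" "in_sub B W (rev t' @ a # t)"
      by (auto simp: schreier_gen_def simp del: key.simps split: option.splits)
    obtain w' where w': "set w' \<subseteq> set B" "\<And>v. v \<in> set pts \<Longrightarrow> ev (rev t' @ a # t) v = ev w' v"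
      using in_subD[OF t'(2)] by blast
    \<comment> \<open>As \<open>w\<close> preserves the block, the coset of \<open>a # s\<close> is
      that of \<open>a # t\<close>, which is the one looked up in \<open>T\<close>.\<close>
    have w\<omega>: "ev w ` set \<omega> = set \<omega>" using keepsD[OF _ \<omega> tw(2)] ok by (simp add: schreier_ok_def)
    have "ev (a # s) ` set \<omega> = (\<lambda>v. act a (ev t v)) ` ev w ` set \<omega>"
      using tw(3) \<omega> by (auto simp: image_image intro!: image_cong)
    then have "ev (a # s) ` set \<omega> = ev (a # t) ` set \<omega>" unfolding w\<omega> by simp
    then have k: "key (Some \<omega>) (a # s) = key (Some \<omega>) (a # t)"
      using key_Some_eq_iff[OF \<omega>] by blast
    have "ev (a # s) v = ev t' (ev (w' @ w) v)" if v: "v \<in> set pts" for v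
    proof -
      let ?u = "ev (a # t) (ev w v)"
      have "?u \<in> set pts" using v ev_pts by blast
      then have "ev t' (ev (rev t') ?u) = ?u" using ev_rev[of ?u "rev t'"] by simp
      moreover have "ev (rev t') ?u = ev w' (ev w v)"
        using w'(2)[OF ev_pts[OF v]] by (simp add: ev_append)
      moreover have "ev (a # s) v = ?u" using tw(3) v by simp
      ultimately show ?thesis by (simp add: ev_append)
    qed
    then show ?case
      using t'(1) w'(1) tw(2) unfolding k by (intro exI[of _ t'] exI[of _ "w' @ w"]) auto
  qed
  moreover have "key (Some \<omega>) s = key (Some \<omega>) []"
    using s(2) key_Some_eq_iff[OF \<omega>, of s "[]"] by (simp del: key.simps)
  ultimately show ?thesis
    using that ok by (auto simp: schreier_ok_def simp del: key.simps)
qed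

text \<open>The final digit of each name is the label of the omitted generator, and each list of
  points is the block belonging to it. Omitting generators in the order 5, 4, 3, 2 leads to 1 + 2 +
  4 + 8 checks.\<close>

lemma schreier_check_5: "schreier_check [Vd, Vf, Vg, Vk, Vm] [R2, R3, R4, R5] [R2, R3, R4]"
  by code_simp

lemma schreier_check_4:
  "schreier_check [Vg, Vm] [R2, R3, R4] [R2, R3]"
  by code_simp

lemma schreier_check_4':
  "schreier_check [Vg, Vm] [R2, R3, R4, R5] [R2, R3, R5]"
  by code_simp

lemma schreier_check_3:
  "schreier_check [X 0, Va] [R2, R3] [R2]"
  "schreier_check [X 0, Va] [R2, R3, R4] [R2, R4]"
  "schreier_check [X 0, Va] [R2, R3, R5] [R2, R5]"
  by code_simp+

lemma schreier_check_3':
  "schreier_check [X 0, Va] [R2, R3, R4, R5] [R2, R4, R5]"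
  by code_simp

lemma schreier_check_2:
  "schreier_check [X 0] [R2] []"
  "schreier_check [X 0] [R2, R3] [R3]"
  "schreier_check [X 0] [R2, R4] [R4]"
  "schreier_check [X 0] [R2, R5] [R5]"
  "schreier_check [X 0] [R2, R3, R4] [R3, R4]"
  "schreier_check [X 0] [R2, R3, R5] [R3, R5]"
  "schreier_check [X 0] [R2, R4, R5] [R4, R5]"
  by code_simp+

lemma schreier_check_2':
  "schreier_check [X 0] [R2, R3, R4, R5] [R3, R4, R5]"
  by code_simp

section \<open>The subgroup generated by the last four generators\<close>

context graph413
begin

definition \<sigma> :: "vert \<Rightarrow> vert" where
  "\<sigma> = swaps 1 ((L - 3) div 2)"

abbreviation M :: "nat \<Rightarrow> (vert \<Rightarrow> vert) set" where
  "M i \<equiv> gp \<rho> ({..<6} - {i})"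

lemma label_range: "range label = {2..5}"
proof -
  have "(UNIV :: gen set) = {R2, R3, R4, R5}"
    using gen.exhaust by blast
  then have "range label = label ` {R2, R3, R4, R5}" by (rule arg_cong)
  then show ?thesis by auto
qed

lemma label_cases:
  assumes "j \<in> {2..5}"
  obtains a where "j = label a"
  using assms unfolding label_range[symmetric] by blast

lemma less6_cases:
  assumes "j < 6"
  obtains "j = 0" | "j = 1" | a where "j = label a"
proof -
  have "j = 0 \<or> j = 1 \<or> j \<in> range label" using assms unfolding label_range by auto
  then show ?thesis using that by auto
qed

lemma act_emb: "emb L (act a (emb L v)) = emb L (act a v)"
  by (cases a; cases v) (auto simp: emb_def)

lemma emb_act_act: "emb L (act a (act a v)) = emb L v"
  by (cases a; cases v) (auto simp: emb_def)

lemma emb_eq_self: "\<not> (\<exists>i. v = X i \<and> i \<noteq> L) \<Longrightarrow> emb L v = v"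
  by (cases v) (auto simp: emb_def)

lemma lift_emb: "lift L a (emb L v) = emb L (act a v)"
proof -
  have "\<not> (\<exists>i. emb L v = X i \<and> i \<noteq> L)" by (cases v) (auto simp: emb_def)
  then show ?thesis by (simp only: lift_def if_False act_emb)
qed

lemma lift_X: "i \<noteq> L \<Longrightarrow> lift L a (X i) = X i"
  by (simp add: lift_def)

lemma emb_simps:
  "emb L (X i) = X L" "emb L Va = Va" "emb L Vb = Vb" "emb L Vc = Vc" "emb L Vd = Vd"
  "emb L Ve = Ve" "emb L Vf = Vf" "emb L Vg = Vg" "emb L Vh = Vh" "emb L Vk = Vk" "emb L Vm = Vm"
  by (simp_all add: emb_def)

lemma lift_simps:
  "lift L a (X i) = (if i = L then emb L (act a (X L)) else X i)"
  "lift L a Va = emb L (act a Va)" "lift L a Vb = emb L (act a Vb)" "lift L a Vc = emb L (act a Vc)"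
  "lift L a Vd = emb L (act a Vd)" "lift L a Ve = emb L (act a Ve)" "lift L a Vf = emb L (act a Vf)"
  "lift L a Vg = emb L (act a Vg)" "lift L a Vh = emb L (act a Vh)" "lift L a Vk = emb L (act a Vk)"
  "lift L a Vm = emb L (act a Vm)"
  by (simp_all add: lift_def)

lemma lift_involution: "lift L a (lift L a v) = v"
proof (cases "\<exists>i. v = X i \<and> i \<noteq> L")
  case True
  then show ?thesis by (auto simp: lift_X)
next
  case False
  then have "v = emb L v" using emb_eq_self by metis
  then show ?thesis by (metis lift_emb emb_act_act)
qed

lemma rho_involution: "j < 6 \<Longrightarrow> \<rho> j \<circ> \<rho> j = id"
  by (erule less6_cases)
     (auto simp: fun_eq_iff rho0 rho1[simplified] rho_label lift_involution swaps_involution)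

lemma V_eq: "V = X ` {1..L} \<union> {Va, Vb, Vc, Vd, Ve, Vf, Vg, Vh, Vk, Vm}"
  by (auto simp: verts413_def n_eq)

lemma finite_V: "finite V"
  by (simp add: V_eq)

lemma lift_outside: "v \<notin> V \<Longrightarrow> lift L a v = v"
  using L5 by (cases v) (auto simp: V_eq lift_def)

lemma rho_permutes:
  assumes "j < 6" shows "\<rho> j permutes V"
proof -
  have "\<rho> j v = v" if "v \<notin> V" for v
    using assms
  proof (cases rule: less6_cases)
    case 1
    then show ?thesis using that by (cases v) (auto simp: rho0 swaps_X V_eq)
  next
    case 2
    then show ?thesis using that L5 by (cases v) (auto simp: rho1[simplified] swaps_X V_eq)
  next
    case 3
    then show ?thesis using that by (simp add: rho_label lift_outside)
  qed
  moreover have "\<exists>!w. \<rho> j w = v" for v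
    using rho_involution[OF assms] by (metis comp_apply id_apply)
  ultimately show ?thesis unfolding permutes_def by blast
qed

lemma evenperm_four_transpositions:
  assumes "a1 \<noteq> b1" "a2 \<noteq> b2" "a3 \<noteq> b3" "a4 \<noteq> b4"
  shows "evenperm (transpose a1 b1 \<circ> (transpose a2 b2 \<circ> (transpose a3 b3 \<circ> transpose a4 b4)))"
  using assms
  by (simp add: evenperm_comp permutation_compose permutation_swap_id evenperm_swap del: comp_apply)

lemma lift_transpositions:
  "lift L R2 = transpose (X L) Va \<circ> (transpose Vh Ve \<circ> (transpose Vk Vf \<circ> transpose Vm Vg))"
  "lift L R3 = transpose Va Vb \<circ> (transpose Vc Ve \<circ> (transpose Vd Vf \<circ> transpose Vm Vg))"
  "lift L R4 = transpose Vb Vc \<circ> (transpose Vf Vg \<circ> (transpose Vk Vm \<circ> transpose Vh Ve))"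
  "lift L R5 = transpose Vc Vd \<circ> (transpose Ve Vf \<circ> (transpose Vh Vk \<circ> transpose Vm Vg))"
proof (auto simp only: fun_eq_iff)
  fix v
  show "lift L R2 v = (transpose (X L) Va \<circ> (transpose Vh Ve \<circ> (transpose Vk Vf \<circ> transpose Vm Vg))) v"
    by (cases v) (auto simp: transpose_def lift_simps emb_simps)
  show "lift L R3 v = (transpose Va Vb \<circ> (transpose Vc Ve \<circ> (transpose Vd Vf \<circ> transpose Vm Vg))) v"
    by (cases v) (auto simp: transpose_def lift_simps emb_simps)
  show "lift L R4 v = (transpose Vb Vc \<circ> (transpose Vf Vg \<circ> (transpose Vk Vm \<circ> transpose Vh Ve))) v"
    by (cases v) (auto simp: transpose_def lift_simps emb_simps)
  show "lift L R5 v = (transpose Vc Vd \<circ> (transpose Ve Vf \<circ> (transpose Vh Vk \<circ> transpose Vm Vg))) v"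
    by (cases v) (auto simp: transpose_def lift_simps emb_simps)
qed

text \<open>Each generator is a product of an even number of transpositions:
  \<open>(L - 1) div 2\<close> for labels 0 and 1, which is even as \<open>L\<close> is 1 modulo 4,
  and four for the other labels.\<close>

lemma rho_even: assumes "j < 6" shows "permutation (\<rho> j) \<and> evenperm (\<rho> j)"
proof
  show "permutation (\<rho> j)"
    using rho_permutes[OF assms] finite_V permutation_permutes by blast
  have "even ((L - 1) div 2)" using L_mod L5 by presburger
  then have "evenperm (swaps c ((L - 1) div 2))" for c using swaps_parity by blast
  moreover have "evenperm (lift L a)" for a
    by (cases a) (simp_all only: lift_transpositions evenperm_four_transpositions vert.distinct not_False_eq_True)
  ultimately show "evenperm (\<rho> j)"
    by (cases rule: less6_cases[OF assms]) (simp_all add: rho0 rho1[simplified] rho_label)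
qed

lemma rho0_other: "v \<notin> X ` {..<L} \<Longrightarrow> \<rho> 0 v = v"
  by (cases v) (auto simp: rho0 swaps_X)

lemma rho0_X: "i < L \<Longrightarrow> \<rho> 0 (X i) \<in> X ` {..<L}"
proof -
  assume i: "i < L"
  have "odd i \<Longrightarrow> i \<noteq> L - 1" using L_odd by auto
  then show ?thesis using i by (auto simp: rho0 swaps_X)
qed

lemma lift_image: "v \<notin> X ` {..<L} \<Longrightarrow> lift L a v \<notin> X ` {..<L}"
  by (cases a; cases v) (auto simp: lift_simps emb_simps)

lemma lift_not_R2_X: "a \<noteq> R2 \<Longrightarrow> lift L a (X i) = X i"
  by (cases a) (auto simp: lift_simps emb_simps)

lemma lift_not_R2_X_iff: "a \<noteq> R2 \<Longrightarrow> lift L a v \<in> range X \<longleftrightarrow> v \<in> range X"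
  by (cases a; cases v) (auto simp: lift_simps emb_simps)

lemma rho1_other: "v \<notin> range X \<Longrightarrow> \<rho> 1 v = v"
  by (cases v) (auto simp: rho1[simplified])

lemma rho01_X: "\<rho> 0 (X i) \<in> range X" "\<rho> 1 (X i) \<in> range X"
  by (auto simp: rho1[simplified] rho0 swaps_X)

text \<open>The support of \<open>\<rho> 0\<close> lies in the points before \<open>x_L\<close> and
  so avoids \<open>\<rho> 2, \<dots>, \<rho> 5\<close>. The support of \<open>\<rho> 1\<close> meets
  among these only that of \<open>\<rho> 2\<close>. The remaining pairs are evaluated
  pointwise.\<close>

lemma rho_commute:
  assumes "i < 6" "j < 6" "i + 2 \<le> j"
  shows "\<rho> i \<circ> \<rho> j = \<rho> j \<circ> \<rho> i"
proof -
  have j: "j \<in> {2..5}" using assms by auto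
  show ?thesis
    using assms(1)
  proof (cases rule: less6_cases)
    case 1
    obtain a where a: "j = label a" using j label_cases by blast
    have "\<rho> 0 (lift L a v) = lift L a (\<rho> 0 v)" for v
    proof (cases "v \<in> X ` {..<L}")
      case True
      then obtain i where i: "v = X i" "i < L" by auto
      then obtain k where "\<rho> 0 v = X k" "k < L" using rho0_X by auto
      then show ?thesis using i lift_X by simp
    qed (simp add: lift_image rho0_other)
    then show ?thesis using 1 a by (auto simp: rho_label)
  next
    case 2
    obtain a where a: "j = label a" using j label_cases by blast
    then have a: "j = label a" "a \<noteq> R2" using 2 assms(3) by auto
    have "\<rho> 1 (lift L a v) = lift L a (\<rho> 1 v)" for v
    proof (cases "v \<in> range X")
      case True
      then obtain k where "\<rho> 1 v = X k" using rho01_X by auto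
      then show ?thesis using True lift_not_R2_X[OF a(2)] by auto
    qed (simp add: rho1_other[simplified] lift_not_R2_X_iff[OF a(2)])
    then show ?thesis using 2 a by (auto simp: rho_label)
  next
    case (3 a)
    obtain b where b: "j = label b" using j label_cases by blast
    have "label a + 2 \<le> label b" using 3 b assms(3) by simp
    then have "lift L a (lift L b v) = lift L b (lift L a v)" for v
      by (cases a; cases b; cases v) (simp_all add: lift_simps emb_simps)
    then show ?thesis using 3 b by (auto simp: rho_label)
  qed
qed

section \<open>Blocks attached to the omitted generators\<close>

fun block :: "gen \<Rightarrow> vert list" where
  "block R2 = [X 0]"
| "block R3 = [X 0, Va]"
| "block R4 = [Vg, Vm]"
| "block R5 = [Vd, Vf, Vg, Vk, Vm]"

text \<open>The connected component of the block after the edges labelled \<open>label a\<close> are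
  deleted, enlarged for \<open>R2\<close> and \<open>R3\<close> by the fixed points
  \<open>X i\<close> outside the graph.\<close>

fun component :: "gen \<Rightarrow> vert set" where
  "component R2 = range X"
| "component R3 = insert Va (range X)"
| "component R4 = {Vg, Vm}"
| "component R5 = {Vd, Vf, Vg, Vk, Vm}"

lemma rho_component:
  assumes "j < 6" "j \<noteq> label a" "v \<in> component a"
  shows "\<rho> j v \<in> component a"
  using assms(1)
proof (cases rule: less6_cases)
  case 1
  then show ?thesis using assms by (cases a) (auto simp: rho0 swaps_X)
next
  case 2
  then show ?thesis using assms by (cases a) (auto simp: rho1[simplified] swaps_X)
next
  case (3 b)
  then have "\<rho> j v = lift L b v" "a \<noteq> b" using assms(2) by (auto simp: rho_label)
  then show ?thesis using assms(3) by (cases a; cases b) (auto simp: lift_simps emb_simps split: if_splits)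
qed

lemma rho_range_emb:
  assumes "j \<in> {2..5}" "v \<in> range (emb L)"
  shows "\<rho> j v \<in> range (emb L)"
proof -
  obtain a where "j = label a" using assms(1) label_cases by blast
  then show ?thesis using assms(2) lift_emb rho_label by auto
qed

lemma block_component: "emb L ` set (block a) = range (emb L) \<inter> component a"
proof -
  have "v \<in> range (emb L) \<longleftrightarrow> v = X L \<or> v \<notin> range X" for v
  proof
    assume "v = X L \<or> v \<notin> range X"
    then have "v = emb L v" by (cases v) (auto simp: emb_def)
    then show "v \<in> range (emb L)" by (metis rangeI)
  qed (auto simp: emb_def split: vert.splits)
  then show ?thesis by (cases a) (auto simp: emb_def)
qed

text \<open>Elements of \<open>M (label a)\<close> preserve the component and tail elements preserve
  the eleven points, so both together preserve the block. Finiteness turns inclusion into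
  equality.\<close>

lemma block_preserved:
  assumes "p \<in> gp \<rho> {2..5}" "p \<in> M (label a)"
  shows "p ` emb L ` set (block a) = emb L ` set (block a)"
proof -
  have "p permutes V" using assms(2) by (rule gp_permutes) (auto intro: rho_permutes)
  then have "inj_on p (emb L ` set (block a))" by (meson inj_on_subset permutes_inj subset_UNIV)
  moreover have "p ` emb L ` set (block a) \<subseteq> emb L ` set (block a)"
    unfolding block_component
    using gp_closed[OF assms(1), of "range (emb L)"] gp_closed[OF assms(2), of "component a"]
      rho_range_emb rho_component by blast
  ultimately show ?thesis by (simp add: endo_inj_surj)
qed

section \<open>Transfer of the checks to the actual generators\<close>

definition perm_of_word :: "gen list \<Rightarrow> vert \<Rightarrow> vert" where
  "perm_of_word w = foldr (\<lambda>a p. \<rho> (label a) \<circ> p) w id"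

lemma perm_of_word_simps [simp]:
  "perm_of_word [] = id" "perm_of_word (a # w) = \<rho> (label a) \<circ> perm_of_word w"
  by (simp_all add: perm_of_word_def)

lemma perm_of_word_emb: "perm_of_word w (emb L v) = emb L (ev w v)"
  by (induction w) (auto simp: rho_label lift_emb)

lemma perm_of_word_X: "i \<noteq> L \<Longrightarrow> perm_of_word w (X i) = X i"
  by (induction w) (auto simp: rho_label lift_X)

lemma perm_of_word_gp: "set w \<subseteq> A \<Longrightarrow> perm_of_word w \<in> gp \<rho> (label ` A)"
  by (induction w) (auto simp del: comp_apply id_apply intro: gp.intros)

lemma gp_words:
  assumes "p \<in> gp \<rho> (label ` A)"
  shows "\<exists>w. set w \<subseteq> A \<and> p = perm_of_word w"
  using assms
proof (induction rule: gp.induct)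
  case gp_id
  show ?case by (rule exI[of _ "[]"]) (simp add: perm_of_word_def)
next
  case (gp_step j p)
  then obtain w where w: "set w \<subseteq> A" "p = perm_of_word w" by blast
  obtain a where a: "j = label a" "a \<in> A" using gp_step.hyps by blast
  show ?case
    by (rule exI[of _ "a # w"]) (use a w in \<open>simp del: comp_apply\<close>)
qed

lemma emb_pts: "\<exists>u \<in> set pts. emb L u = emb L v"
  by (cases v) (auto simp: pts_set emb_def)

lemma emb_inj: "inj_on (emb L) (set pts)"
  by (auto simp: pts_set inj_on_def emb_def)

text \<open>Every word fixes all points other than the eleven, so agreement on \<open>pts\<close> is
  enough.\<close>

lemma perm_of_word_cong:
  assumes "\<And>v. v \<in> set pts \<Longrightarrow> ev s v = ev w v"
  shows "perm_of_word s = perm_of_word w"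
proof
  fix v
  show "perm_of_word s v = perm_of_word w v"
  proof (cases "\<exists>i. v = X i \<and> i \<noteq> L")
    case True
    then show ?thesis using perm_of_word_X by auto
  next
    case False
    then obtain u where "u \<in> set pts" "v = emb L u" using emb_pts emb_eq_self by metis
    then show ?thesis using assms perm_of_word_emb by metis
  qed
qed

lemma check_step:
  assumes "schreier_check (block a) A B" "p \<in> gp \<rho> {2..5}" "p \<in> gp \<rho> (label ` set A)" "p \<in> M (label a)"
  shows "p \<in> gp \<rho> (label ` set B)"
proof -
  obtain s where s: "set s \<subseteq> set A" "p = perm_of_word s"
    using gp_words[OF assms(3)] by blast
  have sub: "set (block a) \<subseteq> set pts" by (cases a) (auto simp: pts_set)
  have "emb L ` ev s ` set (block a) = emb L ` set (block a)"
    using block_preserved[OF assms(2,4)] unfolding s(2) image_image perm_of_word_emb .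
  then have "ev s ` set (block a) = set (block a)"
    using inj_on_image_eq_iff[OF emb_inj] sub ev_pts by (metis image_subset_iff subset_iff)
  then obtain w where "set w \<subseteq> set B" "\<And>v. v \<in> set pts \<Longrightarrow> ev s v = ev w v"
    using schreier assms(1) sub s(1) unfolding schreier_check_def by metis
  then show ?thesis using perm_of_word_cong perm_of_word_gp s(2) by metis
qed

text \<open>The generators with label in \<open>C\<close> are dropped one at a time in the order 5,
  4, 3, 2, so only sets covered by the checks occur as intermediate stages.\<close>

lemma tail_intersection:
  assumes p: "p \<in> gp \<rho> {2..5}" and C: "\<And>i. i \<in> C \<Longrightarrow> p \<in> M i"
  shows "p \<in> gp \<rho> ({2..5} - C)"
proof -
  let ?g = "\<lambda>J. p \<in> gp \<rho> J"
  have all: "?g {2,3,4,5}"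
  proof -
    have "{2..5} = {2,3,4,5::nat}" by auto
    then show ?thesis using p by simp
  qed
  note step = check_step[OF _ p]
  have 5: "5 \<in> C \<Longrightarrow> ?g {2, 3, 4, 5} \<Longrightarrow> ?g {2, 3, 4}"
    using step[of R5 "[R2, R3, R4, R5]" "[R2, R3, R4]"]
      schreier_check_5 C[of 5] by simp_all
  have 4: "4 \<in> C \<Longrightarrow> ?g {2, 3, 4, 5} \<Longrightarrow> ?g {2, 3, 5}"
    "4 \<in> C \<Longrightarrow> ?g {2, 3, 4} \<Longrightarrow> ?g {2, 3}"
    using step[of R4 "[R2, R3, R4, R5]" "[R2, R3, R5]"]
      step[of R4 "[R2, R3, R4]" "[R2, R3]"]
      schreier_check_4 schreier_check_4' C[of 4] by simp_all
  have 3: "3 \<in> C \<Longrightarrow> ?g {2, 3, 4, 5} \<Longrightarrow> ?g {2, 4, 5}"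
    "3 \<in> C \<Longrightarrow> ?g {2, 3, 4} \<Longrightarrow> ?g {2, 4}"
    "3 \<in> C \<Longrightarrow> ?g {2, 3, 5} \<Longrightarrow> ?g {2, 5}"
    "3 \<in> C \<Longrightarrow> ?g {2, 3} \<Longrightarrow> ?g {2}"
    using step[of R3 "[R2, R3, R4, R5]" "[R2, R4, R5]"]
      step[of R3 "[R2, R3, R4]" "[R2, R4]"]
      step[of R3 "[R2, R3, R5]" "[R2, R5]"]
      step[of R3 "[R2, R3]" "[R2]"]
      schreier_check_3 schreier_check_3' C[of 3] by simp_all
  have 2: "2 \<in> C \<Longrightarrow> ?g {2, 3, 4, 5} \<Longrightarrow> ?g {3, 4, 5}"
    "2 \<in> C \<Longrightarrow> ?g {2, 3, 4} \<Longrightarrow> ?g {3, 4}"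
    "2 \<in> C \<Longrightarrow> ?g {2, 3, 5} \<Longrightarrow> ?g {3, 5}"
    "2 \<in> C \<Longrightarrow> ?g {2, 4, 5} \<Longrightarrow> ?g {4, 5}"
    "2 \<in> C \<Longrightarrow> ?g {2, 3} \<Longrightarrow> ?g {3}"
    "2 \<in> C \<Longrightarrow> ?g {2, 4} \<Longrightarrow> ?g {4}"
    "2 \<in> C \<Longrightarrow> ?g {2, 5} \<Longrightarrow> ?g {5}"
    "2 \<in> C \<Longrightarrow> ?g {2} \<Longrightarrow> ?g {}"
    using step[of R2 "[R2, R3, R4, R5]" "[R3, R4, R5]"]
      step[of R2 "[R2, R3, R4]" "[R3, R4]"]
      step[of R2 "[R2, R3, R5]" "[R3, R5]"]
      step[of R2 "[R2, R4, R5]" "[R4, R5]"]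
      step[of R2 "[R2, R3]" "[R3]"]
      step[of R2 "[R2, R4]" "[R4]"]
      step[of R2 "[R2, R5]" "[R5]"]
      step[of R2 "[R2]" "[]"]
      schreier_check_2 schreier_check_2' C[of 2] by simp_all
  have eq: "{2..5} - C = (if 2 \<in> C then {} else {2}) \<union> (if 3 \<in> C then {} else {3})
      \<union> (if 4 \<in> C then {} else {4}) \<union> (if 5 \<in> C then {} else {5})"
    by (auto simp: le_Suc_eq numeral_eq_Suc)
  show ?thesis
    unfolding eq using all 2 3 4 5
    by (cases "2 \<in> C"; cases "3 \<in> C"; cases "4 \<in> C"; cases "5 \<in> C") (simp_all add: insert_commute)
qed

end

section \<open>The intersection property\<close>

lemma conjugate_transpose:
  assumes "w \<circ> w' = id" "w' \<circ> w = id"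
  shows "w \<circ> transpose a b \<circ> w' = transpose (w a) (w b)"
proof
  fix v
  have "w (w' v) = v" "\<And>u. w' (w u) = u" using assms by (metis comp_apply id_apply)+
  then show "(w \<circ> transpose a b \<circ> w') v = transpose (w a) (w b) v"
    by (metis comp_apply transpose_apply_first transpose_apply_second transpose_apply_other)
qed

context graph413
begin

section \<open>The odd factor of the second generator\<close>

lemma sigma_involution: "\<sigma> \<circ> \<sigma> = id"
  by (auto simp: \<sigma>_def fun_eq_iff swaps_involution)

lemma sigma_odd: "permutation \<sigma> \<and> \<not> evenperm \<sigma>"
proof -
  have "odd ((L - 3) div 2)" using L_mod L5 by presburger
  then show ?thesis using swaps_parity unfolding \<sigma>_def by blast
qed

lemma rho1_sigma: "\<rho> 1 = transpose (X (L - 1)) (X L) \<circ> \<sigma>"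
proof -
  have "(L - 1) div 2 = Suc ((L - 3) div 2)" using L5 by linarith
  moreover have "1 + 2 * ((L - 3) div 2) + 1 = L - 1" "1 + 2 * ((L - 3) div 2) + 2 = L"
    using L5 L_mod by presburger+
  ultimately show ?thesis unfolding rho1 \<sigma>_def by (simp only: swaps_Suc)
qed

lemma sigma_low: "i < L - 1 \<Longrightarrow> \<sigma> (X i) \<in> X ` {..<L - 1}"
proof -
  assume i: "i < L - 1"
  have L: "2 * ((L - 3) div 2) = L - 3" using L_mod L5 by presburger
  have "even i \<Longrightarrow> i \<noteq> L - 2" using L_odd L5 by auto
  then show ?thesis using i by (auto simp: \<sigma>_def swaps_X L)
qed

lemma sigma_other: "v \<notin> X ` {..<L - 1} \<Longrightarrow> \<sigma> v = v"
proof -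
  assume v: "v \<notin> X ` {..<L - 1}"
  have L: "2 * ((L - 3) div 2) = L - 3" using L_mod L5 by presburger
  show ?thesis using v L5 by (cases v) (auto simp: \<sigma>_def swaps_X L)
qed

lemma lift_low_iff: "lift L a v \<in> X ` {..<L - 1} \<longleftrightarrow> v \<in> X ` {..<L - 1}"
  by (cases a; cases v) (auto simp: lift_simps emb_simps)

lemma sigma_lift: "\<sigma> (lift L a v) = lift L a (\<sigma> v)"
proof (cases "v \<in> X ` {..<L - 1}")
  case True
  then obtain i where i: "v = X i" "i < L - 1" by auto
  then obtain k where k: "\<sigma> (X i) = X k" "k < L - 1" using sigma_low by auto
  show ?thesis using i k by (simp add: lift_X)
qed (metis sigma_other lift_low_iff)

lemma tail_fixes_X:
  assumes "w \<in> gp \<rho> B" "B \<subseteq> {2..5}" "i \<noteq> L"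
  shows "w (X i) = X i"
proof (rule gp_fixes[OF assms(1)])
  fix j assume "j \<in> B"
  then obtain a where "j = label a" using assms(2) label_cases by blast
  then show "\<rho> j (X i) = X i" using assms(3) by (simp add: rho_label lift_X)
qed

lemma tail_sigma:
  assumes "w \<in> gp \<rho> B" "B \<subseteq> {2..5}"
  shows "w \<circ> \<sigma> = \<sigma> \<circ> w"
proof (rule gp_commute[OF assms(1)])
  fix j assume "j \<in> B"
  then obtain a where "j = label a" using assms(2) label_cases by blast
  then show "\<rho> j \<circ> \<sigma> = \<sigma> \<circ> \<rho> j" by (simp add: rho_label fun_eq_iff sigma_lift)
qed

lemma tail_inverse:
  assumes "w \<in> gp \<rho> B" "B \<subseteq> {..<6}"
  obtains w' where "w' \<in> gp \<rho> B" "w' \<circ> w = id" "w \<circ> w' = id"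
  using gp_inverse[OF assms(1)] rho_involution assms(2) by (metis lessThan_iff subsetD)

text \<open>On the points \<open>X i\<close> with \<open>i < L - 1\<close>, \<open>\<rho> 1\<close>
  acts as \<open>\<sigma>\<close> and \<open>\<rho> 2, \<dots>, \<rho> 5\<close> act trivially. So
  \<open>M 0\<close> acts there through the two-element group generated by
  \<open>\<sigma>\<close>.\<close>

lemma M0_low:
  assumes "g \<in> M 0"
  shows "\<exists>s. (s = id \<or> s = \<sigma>) \<and> (\<forall>i<L - 1. g (X i) = s (X i))"
  using assms
proof (induction rule: gp.induct)
  case gp_id
  show ?case by (rule exI[of _ id]) blast
next
  case (gp_step j p)
  then obtain s where s: "s = id \<or> s = \<sigma>" "\<And>i. i < L - 1 \<Longrightarrow> p (X i) = s (X i)" by blast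
  have low: "i < L - 1 \<Longrightarrow> s (X i) \<in> X ` {..<L - 1}" for i using s(1) sigma_low by auto
  have "j < 6" "j \<noteq> 0" using gp_step.hyps by auto
  then show ?case
  proof (cases rule: less6_cases)
    case 2
    have "\<rho> 1 v = \<sigma> v" if v: "v \<in> X ` {..<L - 1}" for v
    proof -
      have "\<sigma> v \<in> X ` {..<L - 1}" using v sigma_low by auto
      then have "\<sigma> v \<noteq> X (L - 1)" "\<sigma> v \<noteq> X L" by auto
      then show ?thesis by (simp add: rho1_sigma[simplified])
    qed
    then have "\<And>i. i < L - 1 \<Longrightarrow> (\<rho> 1 \<circ> p) (X i) = (\<sigma> \<circ> s) (X i)"
      using s low by simp
    moreover have "\<sigma> \<circ> s = id \<or> \<sigma> \<circ> s = \<sigma>" using s(1) sigma_involution by (metis comp_id)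
    ultimately show ?thesis using 2 by blast
  next
    case (3 a)
    have "\<rho> j v = v" if "v \<in> X ` {..<L - 1}" for v
      using that 3 by (auto simp: rho_label lift_X)
    then have "\<And>i. i < L - 1 \<Longrightarrow> (\<rho> j \<circ> p) (X i) = s (X i)"
      using s low by simp
    then show ?thesis using s(1) by blast
  qed simp
qed

definition tail_orbit :: "nat set \<Rightarrow> vert set" where
  "tail_orbit B = (\<lambda>w. w (X L)) ` gp \<rho> B"

lemma tail_orbit_base: "X L \<in> tail_orbit B"
  using gp.gp_id[of \<rho> B] unfolding tail_orbit_def by (metis id_apply image_eqI)

lemma tail_orbit_step: "j \<in> B \<Longrightarrow> y \<in> tail_orbit B \<Longrightarrow> \<rho> j y \<in> tail_orbit B"
proof -
  assume j: "j \<in> B" and "y \<in> tail_orbit B"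
  then obtain w where "w \<in> gp \<rho> B" "y = w (X L)" unfolding tail_orbit_def by blast
  then have "\<rho> j y = (\<rho> j \<circ> w) (X L)" "\<rho> j \<circ> w \<in> gp \<rho> B"
    using gp.gp_step[OF j] by auto
  then show ?thesis unfolding tail_orbit_def by (rule image_eqI)
qed

lemma gp_permutes_V: "p \<in> gp \<rho> J \<Longrightarrow> J \<subseteq> {..<6} \<Longrightarrow> p permutes V"
  by (rule gp_permutes) (auto intro: rho_permutes)

lemma gp_even: "p \<in> gp \<rho> J \<Longrightarrow> J \<subseteq> {..<6} \<Longrightarrow> permutation p \<and> evenperm p"
  by (rule gp_evenperm) (auto dest: rho_even)

lemma finite_tail_orbit:
  assumes "B \<subseteq> {..<6}" shows "finite (tail_orbit B)"
proof -
  have "X L \<in> V" using L5 by (auto simp: V_eq)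
  then have "tail_orbit B \<subseteq> V"
    unfolding tail_orbit_def using gp_permutes_V[OF _ assms] permutes_in_image by fastforce
  then show ?thesis using finite_V finite_subset by blast
qed

text \<open>The tail element \<open>w\<close> taking \<open>x_L\<close> to \<open>y\<close> fixes
  \<open>x_{L-1}\<close> and commutes with \<open>\<sigma>\<close>, hence it conjugates
  \<open>\<rho> 1\<close> to \<open>(x_{L-1} y)\<close> times \<open>\<sigma>\<close>. Both orders
  of the factors are reached since \<open>\<sigma>\<close> fixes \<open>x_{L-1}\<close> and
  \<open>x_L\<close>.\<close>

lemma star_transpositions:
  assumes B: "B \<subseteq> {2..5}" and y: "y \<in> tail_orbit B"
  shows "\<sigma> \<circ> transpose (X (L - 1)) y \<in> gp \<rho> (insert 1 B)
    \<and> transpose (X (L - 1)) y \<circ> \<sigma> \<in> gp \<rho> (insert 1 B)"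
proof -
  obtain w where w: "w \<in> gp \<rho> B" "y = w (X L)" using y unfolding tail_orbit_def by blast
  obtain w' where w': "w' \<in> gp \<rho> B" "w' \<circ> w = id" "w \<circ> w' = id"
    using tail_inverse[OF w(1)] B by force
  let ?t = "transpose (X (L - 1)) (X L)"
  have conj: "w \<circ> ?t \<circ> w' = transpose (X (L - 1)) y"
    using conjugate_transpose[OF w'(3,2), of "X (L - 1)" "X L"] tail_fixes_X[OF w(1) B, of "L - 1"] w(2) L5
    by simp
  have "\<sigma> \<circ> ?t \<circ> \<sigma> = transpose (\<sigma> (X (L - 1))) (\<sigma> (X L))"
    by (rule conjugate_transpose[OF sigma_involution sigma_involution])
  moreover have "\<sigma> (X (L - 1)) = X (L - 1)" "\<sigma> (X L) = X L" by (rule sigma_other; auto)+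
  ultimately have "\<sigma> \<circ> ?t \<circ> \<sigma> = ?t" by (simp only:)
  then have t\<sigma>: "?t \<circ> \<sigma> = \<sigma> \<circ> ?t" by (metis comp_assoc comp_id sigma_involution)
  have "w \<circ> \<rho> 1 \<circ> w' = w \<circ> ?t \<circ> (\<sigma> \<circ> w')" by (simp add: rho1_sigma comp_assoc del: One_nat_def)
  also have "\<dots> = (w \<circ> ?t \<circ> w') \<circ> \<sigma>" using tail_sigma[OF w'(1) B] by (metis comp_assoc)
  finally have 1: "w \<circ> \<rho> 1 \<circ> w' = transpose (X (L - 1)) y \<circ> \<sigma>" unfolding conj .
  have "w \<circ> \<rho> 1 \<circ> w' = (w \<circ> \<sigma>) \<circ> ?t \<circ> w'" unfolding rho1_sigma t\<sigma> by (simp only: comp_assoc)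
  also have "\<dots> = \<sigma> \<circ> (w \<circ> ?t \<circ> w')" using tail_sigma[OF w(1) B] by (metis comp_assoc)
  finally have 2: "w \<circ> \<rho> 1 \<circ> w' = \<sigma> \<circ> transpose (X (L - 1)) y" unfolding conj .
  have "w \<circ> \<rho> 1 \<circ> w' \<in> gp \<rho> (insert 1 B)"
    by (intro gp_comp gp_gen gp_mono[OF w(1)] gp_mono[OF w'(1)]) auto
  then show ?thesis using 1 2 by metis
qed

lemma signed_permutations:
  assumes "B \<subseteq> {2..5}" "p permutes insert (X (L - 1)) (tail_orbit B)"
  shows "(if evenperm p then p else \<sigma> \<circ> p) \<in> gp \<rho> (insert 1 B)"
proof (rule star_transpositions_generate[where Y = "tail_orbit B" and z = "X (L - 1)"])
  show "finite (tail_orbit B)" using assms(1) by (intro finite_tail_orbit) force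
qed (use assms star_transpositions sigma_involution in \<open>auto simp del: comp_apply id_apply intro: gp.gp_id gp_comp\<close>)

text \<open>Here \<open>w\<close> is \<open>g\<close> with the letters 0 and 1 deleted. They move
  only path points, and the union of path and orbit is invariant under the letters from
  \<open>B\<close>.\<close>

lemma head_agrees_with_tail:
  assumes "g \<in> gp \<rho> ({0, 1} \<union> B)" "B \<subseteq> {2..5}"
  shows "\<exists>w \<in> gp \<rho> B. \<forall>v. v \<notin> range X \<union> tail_orbit B \<longrightarrow> g v = w v \<and> w v \<notin> range X \<union> tail_orbit B"
  using assms(1)
proof (induction rule: gp.induct)
  case gp_id
  show ?case by (rule bexI[OF _ gp.gp_id]) simp
next
  case (gp_step j p)
  let ?S = "range X \<union> tail_orbit B"
  obtain w where w: "w \<in> gp \<rho> B" "\<And>v. v \<notin> ?S \<Longrightarrow> p v = w v \<and> w v \<notin> ?S"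
    using gp_step.IH by blast
  show ?case
  proof (cases "j \<in> B")
    case True
    then obtain a where a: "j = label a" using assms(2) label_cases by blast
    have S: "\<rho> j v \<in> ?S" if "v \<in> ?S" for v
    proof (cases "v \<in> tail_orbit B")
      case True
      then show ?thesis using tail_orbit_step \<open>j \<in> B\<close> by blast
    next
      case False
      then obtain i where "v = X i" "i \<noteq> L" using \<open>v \<in> ?S\<close> tail_orbit_base by auto
      then show ?thesis using a by (simp add: rho_label lift_X)
    qed
    have "\<rho> j (\<rho> j v) = v" for v using a by (simp add: rho_label lift_involution)
    then have "\<rho> j v \<notin> ?S" if "v \<notin> ?S" for v using S that by metis
    then show ?thesis
      using w by (intro bexI[OF _ gp.gp_step[OF True w(1)]]) simp
  next
    case False
    then have "j = 0 \<or> j = 1" using gp_step.hyps by auto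
    then have "\<rho> j v = v" if "v \<notin> ?S" for v
      using that by (cases v) (auto simp: rho0 rho1[simplified])
    then show ?thesis using w by (intro bexI[OF _ w(1)]) simp
  qed
qed

text \<open>
  Divide \<open>g\<close> by the word \<open>w\<close> in the generators from \<open>B\<close> which agrees with it off the path and the orbit of \<open>x_L\<close>.
  The quotient is \<open>id\<close> or \<open>\<sigma>\<close> times a permutation of that orbit and \<open>x_{L-1}\<close>, with parity fixed by \<open>g\<close> being even.
\<close>

lemma facet_vertex_intersection:
  assumes g: "g \<in> gp \<rho> ({0, 1} \<union> B)" and B: "B \<subseteq> {2..5}" and g0: "g \<in> M 0"
  shows "g \<in> gp \<rho> (insert 1 B)"
proof -
  let ?S = "range X \<union> tail_orbit B" and ?Y = "insert (X (L - 1)) (tail_orbit B)"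
  have B6: "B \<subseteq> {..<6}" using B by auto
  obtain w where w: "w \<in> gp \<rho> B" "\<And>v. v \<notin> ?S \<Longrightarrow> g v = w v \<and> w v \<notin> ?S"
    using head_agrees_with_tail[OF g B] by blast
  obtain w' where w': "w' \<in> gp \<rho> B" "w' \<circ> w = id" "w \<circ> w' = id"
    using tail_inverse[OF w(1) B6] by blast
  have ww': "w (w' v) = v" for v using w'(3) by (metis comp_apply id_apply)
  obtain s where s: "s = id \<or> s = \<sigma>" "\<And>i. i < L - 1 \<Longrightarrow> g (X i) = s (X i)"
    using M0_low[OF g0] by blast
  have ss: "s \<circ> s = id" using s(1) sigma_involution by auto
  then have ssv: "s (s v) = v" for v by (metis comp_apply id_apply)
  have s_other: "s v = v" if "v \<notin> X ` {..<L - 1}" for v using s(1) sigma_other that by auto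
  have gV: "g permutes V" using gp_permutes_V[OF g0] by blast
  let ?g' = "g \<circ> w'"
  let ?p = "s \<circ> ?g'"
  have g': "permutation ?g' \<and> evenperm ?g'"
    using gp_even[OF g0] gp_even[OF w'(1) B6] by (simp add: evenperm_comp permutation_compose del: comp_apply)
  have sperm: "permutation s" using s(1) sigma_odd by auto
  have outside: "?p v = v" if v: "v \<notin> ?Y" for v
  proof (cases "v \<in> range X")
    case True
    then obtain i where i: "v = X i" by auto
    have iL: "i \<noteq> L" "i \<noteq> L - 1" using v i tail_orbit_base by auto
    have "w' v = v" using tail_fixes_X[OF w'(1) B iL(1)] i by simp
    moreover have "s (g v) = v"
    proof (cases "i < L - 1")
      case True
      then show ?thesis using s(2) i ssv by simp
    next
      case False
      then have "v \<notin> V" using i iL by (auto simp: V_eq)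
      then have "g v = v" using gV permutes_not_in by metis
      then show ?thesis using s_other i False by auto
    qed
    ultimately show ?thesis by simp
  next
    case False
    then have "v \<notin> ?S" using v by auto
    \<comment> \<open>\<open>?S\<close> is invariant under \<open>w\<close>: it maps the orbit into
      itself and fixes the other path points. Its complement is therefore invariant under
      \<open>w'\<close>.\<close>
    moreover have "w' v \<notin> ?S"
    proof
      assume "w' v \<in> ?S"
      then have "w (w' v) \<in> ?S"
      proof
        assume "w' v \<in> range X"
        then obtain i where i: "w' v = X i" by auto
        show ?thesis
        proof (cases "i = L")
          case True
          then have "w (w' v) \<in> tail_orbit B" using i w(1) by (auto simp: tail_orbit_def)
          then show ?thesis by blast
        next
          case False
          then show ?thesis using i tail_fixes_X[OF w(1) B] by auto
        qed
      next
        assume "w' v \<in> tail_orbit B"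
        then obtain u where u: "u \<in> gp \<rho> B" "w' v = u (X L)" by (auto simp: tail_orbit_def)
        have "w (w' v) = (w \<circ> u) (X L)" using u by simp
        then show ?thesis using gp_comp[OF w(1) u(1)] unfolding tail_orbit_def by blast
      qed
      then show False using \<open>v \<notin> ?S\<close> ww' by simp
    qed
    then have "g (w' v) = v" using w(2) ww' by simp
    then show ?thesis using s_other False by auto
  qed
  have "bij ?p" using permutation_bijective permutation_compose[OF sperm] g' by blast
  then have "?p permutes ?Y"
    using outside unfolding permutes_def by (metis bij_pointE)
  then have K: "(if evenperm ?p then ?p else \<sigma> \<circ> ?p) \<in> gp \<rho> (insert 1 B)"
    using signed_permutations[OF B] by blast
  \<comment> \<open>Thus \<open>?p\<close> is even exactly when \<open>s\<close> is the identity. In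
    either branch the factor \<open>s\<close> disappears and \<open>?g'\<close> remains.\<close>
  have "evenperm ?p \<longleftrightarrow> evenperm s" using evenperm_comp[OF sperm] g' by blast
  then have "(if evenperm ?p then ?p else \<sigma> \<circ> ?p) = ?g'"
    using s(1) sigma_odd sigma_involution by (metis comp_assoc evenperm_id id_comp)
  then have "?g' \<in> gp \<rho> (insert 1 B)" using K by simp
  moreover have "g = ?g' \<circ> w" using w'(2) by (simp only: comp_assoc comp_id)
  ultimately show ?thesis using gp_comp gp_mono[OF w(1)] by (metis subset_insertI)
qed

text \<open>Membership in \<open>M c\<close> splits \<open>g\<close> into \<open>y\<close>, with
  letters below \<open>c\<close> and hence in \<open>J\<close>, and \<open>z\<close>, with letters
  above \<open>c\<close>. As 0 is in \<open>J\<close>, \<open>c\<close> is positive and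
  \<open>z\<close> is a tail element; it inherits from \<open>g\<close> every condition for a
  missing index above \<open>c\<close>.\<close>

lemma inter_maximal_parabolics_0:
  assumes "J \<subseteq> {..<6}" "0 \<in> J" "g \<in> gp \<rho> {..<6}" "\<And>i. i \<in> {..<6} - J \<Longrightarrow> g \<in> M i"
  shows "g \<in> gp \<rho> J"
proof (cases "{..<6} - J = {}")
  case True
  then show ?thesis using assms(1,3) by (metis Diff_eq_empty_iff subset_antisym)
next
  case False
  define c where "c = Min ({..<6} - J)"
  have c: "c \<in> {..<6} - J" unfolding c_def using False by (intro Min_in) auto
  have cmin: "\<And>i. i \<in> {..<6} - J \<Longrightarrow> c \<le> i" unfolding c_def by (intro Min_le) auto
  have c1: "1 \<le> c" using c assms(2) by (cases c) auto
  have "g \<in> gp \<rho> ({..<c} \<union> {c<..<6})"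
    using assms(4)[OF c] by (rule gp_mono) auto
  then obtain y z where yz: "y \<in> gp \<rho> {..<c}" "z \<in> gp \<rho> {c<..<6}" "g = y \<circ> z"
  proof (rule gp_union_split)
    fix a b assume "a \<in> {..<c}" "b \<in> {c<..<6}"
    then show "\<rho> a \<circ> \<rho> b = \<rho> b \<circ> \<rho> a" using c by (intro rho_commute) auto
  qed
  obtain y' where y': "y' \<in> gp \<rho> {..<c}" "y' \<circ> y = id"
    using tail_inverse[OF yz(1)] c by force
  have z: "z = y' \<circ> g" using y'(2) yz(3) by (metis comp_assoc id_comp)
  \<comment> \<open>The indices up to \<open>c\<close> are included because \<open>z\<close> has no
    such letters; what remains of \<open>{2..5}\<close> is contained in \<open>J\<close>.\<close>
  let ?C = "({2..5} - J) \<union> {..c}"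
  have "z \<in> M i" if i: "i \<in> ?C" for i
  proof (cases "i \<le> c")
    case True
    then show ?thesis using yz(2) by (elim gp_mono) auto
  next
    case False
    then have "i \<in> {..<6} - J" using i by auto
    then have "g \<in> M i" using assms(4) by blast
    moreover have "y' \<in> M i" using y'(1) False c by (elim gp_mono) auto
    ultimately show ?thesis unfolding z by (rule gp_comp[rotated])
  qed
  moreover have "z \<in> gp \<rho> {2..5}" using yz(2) c1 by (elim gp_mono) auto
  ultimately have "z \<in> gp \<rho> ({2..5} - ?C)" by (intro tail_intersection)
  then have "z \<in> gp \<rho> J" by (rule gp_mono) auto
  moreover have "{..<c} \<subseteq> J"
  proof
    fix i assume "i \<in> {..<c}"
    then have "i < 6" "\<not> c \<le> i" using c by auto
    then show "i \<in> J" using cmin by blast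
  qed
  then have "y \<in> gp \<rho> J" using yz(1) gp_mono by blast
  ultimately show ?thesis unfolding yz(3) by (intro gp_comp)
qed

text \<open>If 0 is not in \<open>J\<close>, the preceding lemma applies to
  \<open>insert 0 J\<close>. The letter 0 is then removed by the parity argument if 1 is in
  \<open>J\<close>, and otherwise by following \<open>x_1\<close>.\<close>

lemma inter_maximal_parabolics:
  assumes J: "J \<subseteq> {..<6}" and g: "g \<in> gp \<rho> {..<6}" "\<And>i. i \<in> {..<6} - J \<Longrightarrow> g \<in> M i"
  shows "g \<in> gp \<rho> J"
proof (cases "0 \<in> J")
  case True
  then show ?thesis using inter_maximal_parabolics_0 assms by blast
next
  case False
  have g0: "g \<in> M 0" using g(2) False by auto
  have gJ: "g \<in> gp \<rho> (insert 0 J)" using inter_maximal_parabolics_0[of "insert 0 J" g] assms by auto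
  show ?thesis
  proof (cases "1 \<in> J")
    case True
    have "insert 0 J \<subseteq> {0, 1} \<union> (J \<inter> {2..5})"
      using J by (auto simp: subset_iff le_Suc_eq numeral_eq_Suc less_Suc_eq)
    then have "g \<in> gp \<rho> ({0, 1} \<union> (J \<inter> {2..5}))" using gJ gp_mono by blast
    then have "g \<in> gp \<rho> (insert 1 (J \<inter> {2..5}))" using facet_vertex_intersection g0 by blast
    then show ?thesis using True by (elim gp_mono) auto
  next
    case 1: False
    have j2: "j < 6 \<and> 2 \<le> j" if "j \<in> J" for j
    proof -
      have "j \<noteq> 0" "j \<noteq> 1" using that 1 False by metis+
      then show ?thesis using J that by auto
    qed
    have "g \<in> gp \<rho> ({0} \<union> J)" using gJ by simp
    then obtain y z where yz: "y \<in> gp \<rho> {0}" "z \<in> gp \<rho> J" "g = y \<circ> z"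
    proof (rule gp_union_split)
      fix a b assume "a \<in> {0::nat}" "b \<in> J"
      then show "\<rho> a \<circ> \<rho> b = \<rho> b \<circ> \<rho> a" using j2[of b] by (intro rho_commute) auto
    qed
    have "y = id \<or> y = \<rho> 0"
      using yz(1)
    proof (induction rule: gp.induct)
      case gp_id
      show ?case by (rule disjI1[OF refl])
    next
      case (gp_step j p)
      then show ?case by (metis comp_id rho_involution singletonD zero_less_numeral)
    qed
    moreover have "y \<noteq> \<rho> 0"
    proof
      assume y: "y = \<rho> 0"
      \<comment> \<open>Only \<open>\<rho> 0\<close> moves \<open>x_1\<close>, while
        \<open>g\<close> lies in \<open>M 0\<close>.\<close>
      have fix1: "\<rho> j (X 1) = X 1" if "j < 6" "j \<noteq> 0" for j
        using that(1)
      proof (cases rule: less6_cases)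
        case 2
        then show ?thesis by (simp add: rho1[simplified] swaps_X)
      next
        case (3 a)
        then show ?thesis using L5 lift_X[of 1 a] by (simp add: rho_label)
      qed (use that in auto)
      have "g (X 1) = X 1" using g0 by (rule gp_fixes) (use fix1 in auto)
      moreover have "z (X 1) = X 1" using yz(2)
        by (rule gp_fixes) (use fix1 j2 in fastforce)
      moreover have "\<rho> 0 (X 1) \<noteq> X 1" using L5 by (simp add: rho0 swaps_X)
      ultimately show False using yz(3) y by simp
    qed
    ultimately show ?thesis using yz by simp
  qed
qed

text \<open>An index \<open>i\<close> outside \<open>J \<inter> K\<close> is missing from one of the
  two sets, whose subgroup then lies in \<open>M i\<close>.\<close>

lemma gp_inter:
  assumes "J \<subseteq> {..<6}" "K \<subseteq> {..<6}"
  shows "gp \<rho> J \<inter> gp \<rho> K = gp \<rho> (J \<inter> K)"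
proof
  show "gp \<rho> (J \<inter> K) \<subseteq> gp \<rho> J \<inter> gp \<rho> K" using gp_mono[of _ \<rho> "J \<inter> K"] by blast
  have "g \<in> gp \<rho> (J \<inter> K)" if g: "g \<in> gp \<rho> J" "g \<in> gp \<rho> K" for g
  proof (rule inter_maximal_parabolics)
    fix i assume i: "i \<in> {..<6} - J \<inter> K"
    show "g \<in> M i"
    proof (cases "i \<in> J")
      case True
      then have "K \<subseteq> {..<6} - {i}" using i assms by auto
      then show ?thesis using g(2) gp_mono by blast
    next
      case False
      then have "J \<subseteq> {..<6} - {i}" using assms by auto
      then show ?thesis using g(1) gp_mono by blast
    qed
  qed (use assms gp_mono[OF g(1)] in auto)
  then show "gp \<rho> J \<inter> gp \<rho> K \<subseteq> gp \<rho> (J \<inter> K)" by blast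
qed

end

section \<open>The full group and the orders of products\<close>

lemma funpow_eq_id_iff:
  assumes "f ^^ d = id" "\<And>k. 0 < k \<Longrightarrow> k < d \<Longrightarrow> f ^^ k \<noteq> id" "d > 0"
  shows "f ^^ k = id \<longleftrightarrow> d dvd k"
proof -
  have "f ^^ k = f ^^ (d * (k div d) + k mod d)" by simp
  also have "\<dots> = (f ^^ d) ^^ (k div d) \<circ> f ^^ (k mod d)"
    by (simp only: funpow_add funpow_mult mult.commute)
  also have "\<dots> = f ^^ (k mod d)" by (simp add: assms(1) del: comp_apply id_apply)
  finally have "f ^^ k = id \<longleftrightarrow> f ^^ (k mod d) = id" by simp
  also have "\<dots> \<longleftrightarrow> k mod d = 0"
    using assms(2)[of "k mod d"] assms(3) by (cases "k mod d = 0") auto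
  finally show ?thesis by (simp add: dvd_eq_mod_eq_0)
qed

text \<open>Carries parity along the relabelling of \<open>V\<close> by \<open>{1..n}\<close>, on
  which \<open>alt_group n\<close> acts: transpositions go to transpositions.\<close>

lemma evenperm_map_permutation:
  assumes f: "inj_on f A" and "finite A" "p permutes A"
  shows "permutation (map_permutation A f p) \<and> (evenperm (map_permutation A f p) \<longleftrightarrow> evenperm p)"
  using assms(3,2)
proof (induction p rule: permutes_induct)
  case id
  show ?case unfolding map_permutation_id'[OF f] by (simp del: id_apply)
next
  case (swap a b p)
  let ?t = "transpose a b"
  have eq: "map_permutation A f (?t \<circ> p) = transpose (f a) (f b) \<circ> map_permutation A f p"
    using map_permutation_compose'[OF f swap.hyps(4)] map_permutation_transpose[OF f swap.hyps(1,2)] by metis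
  have "permutation p" using swap.hyps \<open>finite A\<close> permutation_permutes by blast
  moreover have "f a \<noteq> f b" using f swap.hyps by (meson inj_on_eq_iff)
  ultimately show ?case
    unfolding eq using swap
    by (simp add: evenperm_comp permutation_compose permutation_swap_id evenperm_swap del: comp_apply)
qed

context graph413
begin

text \<open>The steps follow a spanning tree of the edges with labels 2 to 5, starting at
  \<open>x_L\<close>.\<close>

lemma tail_orbit_all: "range (emb L) \<subseteq> tail_orbit {2..5}"
proof -
  let ?O = "tail_orbit {2..5}"
  have step: "lift L a y \<in> ?O" if "y \<in> ?O" for a y
    using that tail_orbit_step[of "label a" "{2..5}" y] label_range rho_label by fastforce
  have x: "X L \<in> ?O" by (rule tail_orbit_base)
  have a: "Va \<in> ?O" using step[OF x, of R2] by (simp add: lift_simps emb_simps)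
  have b: "Vb \<in> ?O" using step[OF a, of R3] by (simp add: lift_simps emb_simps)
  have c: "Vc \<in> ?O" using step[OF b, of R4] by (simp add: lift_simps emb_simps)
  have d: "Vd \<in> ?O" using step[OF c, of R5] by (simp add: lift_simps emb_simps)
  have e: "Ve \<in> ?O" using step[OF c, of R3] by (simp add: lift_simps emb_simps)
  have f: "Vf \<in> ?O" using step[OF d, of R3] by (simp add: lift_simps emb_simps)
  have g: "Vg \<in> ?O" using step[OF f, of R4] by (simp add: lift_simps emb_simps)
  have h: "Vh \<in> ?O" using step[OF e, of R2] by (simp add: lift_simps emb_simps)
  have k: "Vk \<in> ?O" using step[OF f, of R2] by (simp add: lift_simps emb_simps)
  have m: "Vm \<in> ?O" using step[OF g, of R2] by (simp add: lift_simps emb_simps)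
  have "emb L v \<in> ?O" for v
    using x a b c d e f g h k m by (cases v) (simp_all add: emb_simps)
  then show ?thesis by blast
qed

section \<open>Identification with the alternating group\<close>

lemma gp_conj:
  assumes "j \<in> J" "p \<in> gp \<rho> J"
  shows "\<rho> j \<circ> p \<circ> \<rho> j \<in> gp \<rho> J"
  using assms by (intro gp_comp gp_gen)

text \<open>For \<open>x_{L-1}\<close> and the eleven points these products are even permutations of
  the set treated by \<open>signed_permutations\<close>. The rest of the path is reached by
  conjugating alternately with \<open>\<rho> 0\<close> and \<open>\<rho> 1\<close>, which fix
  \<open>a\<close> and \<open>b\<close>.\<close>

lemma three_cycles:
  assumes "v \<in> V" "v \<noteq> Va"
  shows "transpose Va Vb \<circ> transpose Va v \<in> gp \<rho> {..<6} \<and> transpose Va v \<circ> transpose Va Vb \<in> gp \<rho> {..<6}"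
    (is "?P v")
proof -
  let ?G = "gp \<rho> {..<6}"
  have tail: "?P v" if v: "v \<in> insert (X (L - 1)) (range (emb L))" "v \<noteq> Va" for v
  proof -
    let ?Y = "insert (X (L - 1)) (tail_orbit {2..5})"
    have "insert 1 {2..5} \<subseteq> {..<6::nat}" by auto
    then have sub: "gp \<rho> (insert 1 {2..5}) \<subseteq> ?G" using gp_mono by blast
    have Y: "Va \<in> ?Y" "Vb \<in> ?Y" "v \<in> ?Y"
      using tail_orbit_all v emb_simps(2,3) by (metis insertCI rangeI subsetD, metis insertCI rangeI subsetD, blast)
    have G: "p \<in> ?G" if "p permutes ?Y" "evenperm p" for p
      using signed_permutations[OF order.refl that(1)] that(2) sub by auto
    have ev: "evenperm (transpose Va Vb \<circ> transpose Va v)" "evenperm (transpose Va v \<circ> transpose Va Vb)"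
      using v(2) by (simp_all add: evenperm_comp permutation_swap_id evenperm_swap del: comp_apply)
    show ?thesis
      using Y by (intro conjI G ev permutes_compose permutes_swap_id)
  qed
  have path: "?P (X (L - 1 - k))" if "k < L - 1" for k
    using that
  proof (induction k)
    case 0
    then show ?case using tail by simp
  next
    case (Suc k)
    define i where "i = L - 1 - k"
    have i: "L - 1 - Suc k = i - 1" "2 \<le> i" "i \<le> L - 1" "?P (X i)"
      using Suc by (auto simp: i_def)
    \<comment> \<open>This is the label of the edge between \<open>x_{i-1}\<close> and
      \<open>x_i\<close>.\<close>
    define j :: nat where "j = (if even i then 0 else 1)"
    have j: "j \<in> {..<6}" by (simp add: j_def)
    have \<rho>j: "\<rho> j (X i) = X (i - 1)" "\<rho> j Va = Va" "\<rho> j Vb = Vb"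
      using i(2,3) by (auto simp: j_def rho0 rho1[simplified] swaps_X)
    have inv: "\<rho> j \<circ> \<rho> j = id" using j by (intro rho_involution) simp
    let ?s = "transpose Va Vb" and ?t = "transpose Va (X i)"
    have c: "\<rho> j \<circ> ?s \<circ> \<rho> j = ?s" "\<rho> j \<circ> ?t \<circ> \<rho> j = transpose Va (X (i - 1))"
      using conjugate_transpose[OF inv inv] \<rho>j by simp_all
    have dist: "\<rho> j \<circ> (p \<circ> q) \<circ> \<rho> j = (\<rho> j \<circ> p \<circ> \<rho> j) \<circ> (\<rho> j \<circ> q \<circ> \<rho> j)" for p q
      using inv by (metis comp_assoc comp_id)
    have "\<rho> j \<circ> (?s \<circ> ?t) \<circ> \<rho> j = ?s \<circ> transpose Va (X (i - 1))"
      "\<rho> j \<circ> (?t \<circ> ?s) \<circ> \<rho> j = transpose Va (X (i - 1)) \<circ> ?s"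
      by (simp_all only: dist c)
    then show ?case
      unfolding i(1) using gp_conj[OF j] i(4) by metis
  qed
  show ?thesis
  proof (cases "v \<in> X ` {1..L - 1}")
    case True
    then obtain i where i: "v = X i" "1 \<le> i" "i \<le> L - 1" by auto
    then have "L - 1 - i < L - 1" "L - 1 - (L - 1 - i) = i" by auto
    then show ?thesis using path[of "L - 1 - i"] i(1) by (simp only:)
  next
    case False
    have "v = emb L v" using False assms(1) by (cases v) (auto simp: V_eq emb_simps inj_image_mem_iff inj_def)
    then show ?thesis using tail assms(2) by (metis insertCI rangeI)
  qed
qed

lemma gp_all: "gp \<rho> {..<6} = {p. p permutes V \<and> evenperm p}"
proof (intro equalityI subsetI)
  fix p assume "p \<in> gp \<rho> {..<6}"
  then show "p \<in> {p. p permutes V \<and> evenperm p}" using gp_permutes_V gp_even by auto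
next
  fix p assume p: "p \<in> {p. p permutes V \<and> evenperm p}"
  have "(if evenperm p then p else transpose Va Vb \<circ> p) \<in> gp \<rho> {..<6}"
  proof (rule star_transpositions_generate[where Y = V and z = Va])
    have "insert Va V = V" by (auto simp: V_eq)
    then show "p permutes insert Va V" using p by simp
  qed (use three_cycles finite_V in \<open>auto simp del: comp_apply id_apply intro: gp.gp_id gp_comp\<close>)
  then show "p \<in> gp \<rho> {..<6}" using p by simp
qed

lemma group413_simps:
  "mult (group413 n) = (\<circ>)" "one (group413 n) = id" "group (group413 n)"
  "carrier (group413 n) = gp \<rho> {..<6}"
proof -
  interpret P: group "perm_group V" by (rule perm_group_is_group)
  show "mult (group413 n) = (\<circ>)" "one (group413 n) = id" "group (group413 n)"
    by (simp_all add: group413_def perm_group_def P.group_subgroup_generated[unfolded perm_group_def])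
  have "\<rho> ` {..<6} \<subseteq> carrier (perm_group V)" using rho_permutes by (auto simp: perm_group_def)
  moreover from this have "generate (perm_group V) (\<rho> ` {..<6}) = gp \<rho> {..<6}"
    by (intro generate_eq_gp P.is_group) (auto simp: perm_group_def rho_involution simp del: comp_apply id_apply)
  ultimately show "carrier (group413 n) = gp \<rho> {..<6}"
    by (simp add: group413_def carrier_subgroup_generated Int_absorb1)
qed

lemma generate_group413:
  assumes "J \<subseteq> {..<6}"
  shows "generate (group413 n) (\<rho> ` J) = gp \<rho> J"
proof (rule generate_eq_gp)
  show "\<rho> ` J \<subseteq> carrier (group413 n)"
    unfolding group413_simps using assms gp_gen by blast
  show "\<rho> j \<circ> \<rho> j = id" if "j \<in> J" for j using that assms rho_involution by auto
qed (rule group413_simps)+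

lemma card_V: "card V = n"
proof -
  have "card (X ` {1..L}) = L" by (simp add: card_image inj_on_def)
  moreover have "X ` {1..L} \<inter> {Va, Vb, Vc, Vd, Ve, Vf, Vg, Vh, Vk, Vm} = {}" by auto
  ultimately show ?thesis
    unfolding V_eq by (subst card_Un_disjoint) (auto simp: n_eq)
qed

lemma group413_iso: "group413 n \<cong> alt_group n"
proof -
  obtain f where f: "bij_betw f V {1..n}"
    using finite_same_card_bij[OF finite_V, of "{1..n}"] card_V by auto
  have inj: "inj_on f V" using f bij_betw_def by blast
  have inj': "inj_on (inv_into V f) {1..n}" using bij_betw_inv_into[OF f] bij_betw_def by blast
  let ?h = "map_permutation V f" and ?h' = "map_permutation {1..n} (inv_into V f)"
  have h: "?h p \<in> carrier (alt_group n)" if "p \<in> carrier (group413 n)" for p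
    using that map_permutation_permutes[OF f] evenperm_map_permutation[OF inj finite_V]
    unfolding group413_simps gp_all alt_group_carrier by blast
  have h': "?h' q \<in> carrier (group413 n)" if "q \<in> carrier (alt_group n)" for q
    using that map_permutation_permutes[OF bij_betw_inv_into[OF f]]
      evenperm_map_permutation[OF inj' finite_atLeastAtMost]
    unfolding group413_simps gp_all alt_group_carrier by blast
  have "bij_betw ?h (carrier (group413 n)) (carrier (alt_group n))"
  proof (rule bij_betw_byWitness[where f' = ?h'])
    show "\<forall>p\<in>carrier (group413 n). ?h' (?h p) = p"
      unfolding group413_simps gp_all
      using map_permutation_compose_inv[OF f] inv_into_f_f[OF inj] by blast
    show "\<forall>q\<in>carrier (alt_group n). ?h (?h' q) = q"
      unfolding Ball_def alt_group_carrier
      using map_permutation_compose_inv[OF bij_betw_inv_into[OF f]] bij_betw_inv_into_right[OF f] by blast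
  qed (use h h' in auto)
  moreover have "?h (p \<circ> q) = ?h p \<circ> ?h q" if "q \<in> carrier (group413 n)" for p q
    using that map_permutation_compose'[OF inj] unfolding group413_simps gp_all by blast
  ultimately have "?h \<in> iso (group413 n) (alt_group n)"
    using h by (auto simp: iso_def hom_def alt_group_mult group413_simps(1) simp del: comp_apply)
  then show ?thesis unfolding is_iso_def by blast
qed

section \<open>Orders of products of consecutive generators\<close>

lemma ord_group413:
  assumes "i < 6" "j < 6" "(\<rho> i \<circ> \<rho> j) ^^ d = id" "d > 0"
    "\<And>k. 0 < k \<Longrightarrow> k < d \<Longrightarrow> (\<rho> i \<circ> \<rho> j) ^^ k \<noteq> id"
  shows "group.ord (group413 n) (\<rho> i \<otimes>\<^bsub>group413 n\<^esub> \<rho> j) = d"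
proof -
  interpret group "group413 n" by (rule group413_simps)
  have "\<rho> i \<circ> \<rho> j \<in> carrier (group413 n)"
    unfolding group413_simps using assms by (intro gp_comp gp_gen) auto
  then show ?thesis
    unfolding group413_simps(1)
    by (subst ord_unique) (auto simp: pow_eq_funpow group413_simps funpow_eq_id_iff[OF assms(3,5,4)] simp del: id_apply comp_apply)
qed

definition rotation :: "vert \<Rightarrow> vert" where
  "rotation v = \<rho> 0 (\<rho> 1 v)"

text \<open>\<open>\<rho> 0 \<circ> \<rho> 1\<close> is the cycle \<open>x_2, x_4, \<dots>, x_{L-1}, x_L, x_{L-2}, \<dots>, x_3, x_1\<close>, indexed from 1.\<close>

definition rotation_index :: "nat \<Rightarrow> nat" where
  "rotation_index t = (if 2 * t < L then 2 * t else 2 * (L - t) + 1)"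

lemma rotation_X:
  "rotation (X i) = \<rho> 0 (X (if 1 < i \<and> i \<le> L then if even i then i + 1 else i - 1 else i))"
  using L5 by (auto simp: rotation_def rho1[simplified] swaps_X)

lemma rotation_step:
  assumes "1 \<le> t" "t < L"
  shows "rotation (X (rotation_index t)) = X (rotation_index (t + 1))"
proof -
  have "2 * t + 2 \<noteq> L" "2 * t \<noteq> L" using L_odd by auto
  then consider "2 * t + 2 < L" | "2 * t + 1 = L" | "L < 2 * t"
    by linarith
  then show ?thesis
  proof cases
    case 1
    then show ?thesis using assms by (simp add: rotation_index_def rotation_X rho0 swaps_X)
  next
    case 2
    then have "rotation_index t = L - 1" "rotation_index (t + 1) = L"
      by (auto simp: rotation_index_def)
    then show ?thesis using L5 L_odd by (auto simp: rotation_X rho0 swaps_X)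
  next
    case 3
    then show ?thesis using assms by (auto simp: rotation_index_def rotation_X rho0 swaps_X)
  qed
qed

lemma rotation_pow:
  "1 \<le> t \<Longrightarrow> t + k \<le> L \<Longrightarrow> (rotation ^^ k) (X (rotation_index t)) = X (rotation_index (t + k))"
proof (induction k)
  case (Suc k)
  then show ?case using rotation_step[of "t + k"] by simp
qed simp

lemma rotation_L: "rotation_index L = 1" "rotation_index 1 = 2"
  using L5 by (auto simp: rotation_index_def)

lemma rotation_pow_X1:
  assumes "1 \<le> k" "k \<le> L"
  shows "(rotation ^^ k) (X 1) = X (rotation_index k)"
proof -
  obtain m where m: "k = Suc m" using assms by (cases k) auto
  have "rotation (X 1) = X (rotation_index 1)"
    unfolding rotation_L using L5 by (simp add: rotation_X rho0 swaps_X)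
  then have "(rotation ^^ k) (X 1) = (rotation ^^ m) (X (rotation_index 1))"
    unfolding m funpow_Suc_right comp_apply by (rule arg_cong)
  then show ?thesis using rotation_pow[of 1 m] assms m by simp
qed

lemma rotation_surj:
  assumes "1 \<le> i" "i \<le> L"
  obtains t where "1 \<le> t" "t \<le> L" "rotation_index t = i"
proof (cases "even i")
  case True
  then have "i \<noteq> L" using L_odd by auto
  then show ?thesis using that[of "i div 2"] assms True by (auto simp: rotation_index_def)
next
  case False
  then obtain k where "i = 2 * k + 1" by (rule oddE)
  then show ?thesis using that[of "L - k"] assms by (auto simp: rotation_index_def)
qed

text \<open>The orbit of \<open>x_1\<close> passes through all \<open>L\<close> path points and
  first returns to \<open>x_1\<close> after \<open>L\<close> steps; everything else is
  fixed.\<close>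

lemma ord_01: "group.ord (group413 n) (\<rho> 0 \<otimes>\<^bsub>group413 n\<^esub> \<rho> 1) = L"
proof (rule ord_group413)
  have eq: "\<rho> 0 \<circ> \<rho> 1 = rotation" by (auto simp: rotation_def)
  show "(\<rho> 0 \<circ> \<rho> 1) ^^ k \<noteq> id" if "0 < k" "k < L" for k
    unfolding eq
  proof
    assume "rotation ^^ k = id"
    then have "rotation_index k = 1" using rotation_pow_X1[of k] that by simp
    then show False using that by (auto simp: rotation_index_def split: if_splits)
  qed
  show "(\<rho> 0 \<circ> \<rho> 1) ^^ L = id"
    unfolding eq
  proof
    fix v
    show "(rotation ^^ L) v = id v"
    proof (cases "v \<in> X ` {1..L}")
      case True
      then obtain i where i: "v = X i" "1 \<le> i" "i \<le> L" by auto
      obtain t where t: "1 \<le> t" "t \<le> L" "rotation_index t = i"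
        using rotation_surj[OF i(2,3)] .
      \<comment> \<open>The first \<open>L - t\<close> steps lead from \<open>v\<close> to
        \<open>x_1\<close>, the remaining \<open>t\<close> steps from \<open>x_1\<close> back to
        \<open>v\<close>.\<close>
      have "(rotation ^^ L) v = (rotation ^^ t) ((rotation ^^ (L - t)) v)"
        using t(2) funpow_add[of t "L - t" rotation] by simp
      also have "(rotation ^^ (L - t)) v = X 1"
        using rotation_pow[of t "L - t"] t i(1) rotation_L(1) by simp
      also have "(rotation ^^ t) (X 1) = v" using rotation_pow_X1 t i(1) by simp
      finally show ?thesis by simp
    next
      case False
      then have "rotation v = v"
        by (cases v) (auto simp: rotation_X rho0 swaps_X rotation_def rho1[simplified])
      then have "(rotation ^^ k) v = v" for k by (induction k) auto
      then show ?thesis by simp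
    qed
  qed
qed (use L5 in auto)

lemma less_cases:
  "k < 3 \<Longrightarrow> 0 < k \<Longrightarrow> k = 1 \<or> k = (2::nat)" 
  "k < 5 \<Longrightarrow> 0 < k \<Longrightarrow> k = 1 \<or> k = 2 \<or> k = 3 \<or> k = (4::nat)"
  "k < 6 \<Longrightarrow> 0 < k \<Longrightarrow> k = 1 \<or> k = 2 \<or> k = 3 \<or> k = 4 \<or> k = (5::nat)"
  by auto

text \<open>As in the next two lemmas, the power is evaluated on all points, and one point on a
  cycle of full length excludes smaller exponents.\<close>

lemma ord_23: "group.ord (group413 n) (\<rho> 2 \<otimes>\<^bsub>group413 n\<^esub> \<rho> 3) = 3"
proof (rule ord_group413)
  have r: "\<rho> 2 = lift L R2" "\<rho> 3 = lift L R3" using rho_label[of R2] rho_label[of R3] by simp_all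
  show "(\<rho> 2 \<circ> \<rho> 3) ^^ 3 = id"
    unfolding r
  proof
    fix v show "((lift L R2 \<circ> lift L R3) ^^ 3) v = id v"
      by (cases v) (simp_all add: numeral_eq_Suc lift_simps emb_simps)
  qed
  show "(\<rho> 2 \<circ> \<rho> 3) ^^ k \<noteq> id" if "0 < k" "k < 3" for k
    unfolding r
  proof
    assume "(lift L R2 \<circ> lift L R3) ^^ k = id"
    then have "((lift L R2 \<circ> lift L R3) ^^ k) Va = Va" by simp
    then show False using less_cases(1)[OF that(2,1)] by (auto simp: numeral_eq_Suc lift_simps emb_simps)
  qed
qed simp_all

lemma ord_34: "group.ord (group413 n) (\<rho> 3 \<otimes>\<^bsub>group413 n\<^esub> \<rho> 4) = 5"
proof (rule ord_group413)
  have r: "\<rho> 3 = lift L R3" "\<rho> 4 = lift L R4" using rho_label[of R3] rho_label[of R4] by simp_all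
  show "(\<rho> 3 \<circ> \<rho> 4) ^^ 5 = id"
    unfolding r
  proof
    fix v show "((lift L R3 \<circ> lift L R4) ^^ 5) v = id v"
      by (cases v) (simp_all add: numeral_eq_Suc lift_simps emb_simps)
  qed
  show "(\<rho> 3 \<circ> \<rho> 4) ^^ k \<noteq> id" if "0 < k" "k < 5" for k
    unfolding r
  proof
    assume "(lift L R3 \<circ> lift L R4) ^^ k = id"
    then have "((lift L R3 \<circ> lift L R4) ^^ k) Va = Va" by simp
    then show False using less_cases(2)[OF that(2,1)] by (auto simp: numeral_eq_Suc lift_simps emb_simps)
  qed
qed simp_all

lemma ord_45: "group.ord (group413 n) (\<rho> 4 \<otimes>\<^bsub>group413 n\<^esub> \<rho> 5) = 3"
proof (rule ord_group413)
  have r: "\<rho> 4 = lift L R4" "\<rho> 5 = lift L R5" using rho_label[of R4] rho_label[of R5] by simp_all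
  show "(\<rho> 4 \<circ> \<rho> 5) ^^ 3 = id"
    unfolding r
  proof
    fix v show "((lift L R4 \<circ> lift L R5) ^^ 3) v = id v"
      by (cases v) (simp_all add: numeral_eq_Suc lift_simps emb_simps)
  qed
  show "(\<rho> 4 \<circ> \<rho> 5) ^^ k \<noteq> id" if "0 < k" "k < 3" for k
    unfolding r
  proof
    assume "(lift L R4 \<circ> lift L R5) ^^ k = id"
    \<comment> \<open>Both factors fix \<open>Va\<close>; the point \<open>Vb\<close> lies on a
      3-cycle.\<close>
    then have "((lift L R4 \<circ> lift L R5) ^^ k) Vb = Vb" by simp
    then show False using less_cases(1)[OF that(2,1)] by (auto simp: numeral_eq_Suc lift_simps emb_simps)
  qed
qed simp_all

text \<open>The product has the 3-cycle \<open>a\<close>, \<open>x_{L-1}\<close>, \<open>x_L\<close>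
  and the 2-cycle \<open>h\<close>, \<open>e\<close>, and its square fixes every point off the
  3-cycle. So the order is the least common multiple of 3 and 2.\<close>

lemma ord_12: "group.ord (group413 n) (\<rho> 1 \<otimes>\<^bsub>group413 n\<^esub> \<rho> 2) = 6"
proof (rule ord_group413)
  have r: "\<rho> 2 = lift L R2" using rho_label[of R2] by simp
  define s where "s v = \<rho> 1 (\<rho> 2 v)" for v
  have eq: "\<rho> 1 \<circ> \<rho> 2 = s" by (auto simp: s_def)
  have \<rho>1L: "\<rho> 1 (X L) = X (L - 1)" using L5 L_odd by (simp add: rho1[simplified] swaps_X)
  have inv: "\<rho> 1 (\<rho> 1 v) = v" for v using rho_involution[of 1] by (simp add: fun_eq_iff)
  have "\<rho> 1 (X (L - 1)) = X L" using inv \<rho>1L by metis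
  then have orbit: "s Va = X (L - 1)" "s (X (L - 1)) = X L" "s (X L) = Va" "s Vh = Ve" "s Ve = Vh"
    using L5 \<rho>1L by (simp_all add: s_def r lift_simps emb_simps rho1_other[simplified] image_iff)
  have low: "s (s (X i)) = X i" if "i \<noteq> L" "i \<noteq> L - 1" for i
  proof -
    have s: "s (X i) = \<rho> 1 (X i)" using that by (simp add: s_def r lift_X)
    obtain k where k: "\<rho> 1 (X i) = X k" using rho01_X by blast
    have "k \<noteq> L" using inv[of "X i"] k \<rho>1L that by auto
    then show ?thesis using s k inv[of "X i"] by (simp add: s_def r lift_X)
  qed
  have nonX: "s (s v) = v" if "v \<notin> range X" "v \<noteq> Va" for v
    using that by (cases v) (auto simp: s_def r lift_simps emb_simps rho1_other[simplified] image_iff)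
  show "(\<rho> 1 \<circ> \<rho> 2) ^^ 6 = id"
    unfolding eq
  proof
    fix v
    have six: "(s ^^ 6) v = s (s (s (s (s (s v)))))" by (simp add: numeral_eq_Suc)
    consider "v \<in> {Va, X (L - 1), X L}" | "s (s v) = v" using nonX low by (cases v) auto
    then show "(s ^^ 6) v = id v"
      unfolding six by cases (auto simp: orbit[simplified])
  qed
  show "(\<rho> 1 \<circ> \<rho> 2) ^^ k \<noteq> id" if "0 < k" "k < 6" for k
    unfolding eq
  proof
    assume "s ^^ k = id"
    then have "(s ^^ k) Va = Va" "(s ^^ k) Vh = Vh" by simp_all
    then show False
      using less_cases(3)[OF that(2,1)] by (auto simp: numeral_eq_Suc orbit[simplified])
  qed
qed simp_all

section \<open>Well-formedness and the defining conditions\<close>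

lemma edge_iff:
  assumes "k < 6" "v \<noteq> w"
  shows "({v, w}, k) \<in> edges413 n \<longleftrightarrow> \<rho> k v = w"
  using assms(1)
  by (cases rule: less6_cases)
     (simp_all add: edge0_iff[OF assms(2)] edge1_iff[OF assms(2), simplified] edge_label_iff[OF assms(2)] rho0 rho1[simplified] rho_label)

lemma edge_form:
  assumes "(e, k) \<in> edges413 n"
  shows "k < 6 \<and> (\<exists>a b. a \<noteq> b \<and> e = {a, b})"
proof (cases "(e, k) \<in> alt_path_edges (map X [1..<n - 9])")
  case True
  then obtain s where s: "e = {map X [1..<n - 9] ! (s - 1), map X [1..<n - 9] ! s}" "k \<le> 1"
      "1 \<le> s" "s \<le> length (map X [1..<n - 9]) - 1"
    unfolding alt_path_edges_def by fastforce
  then have "s - 1 < n - 9 - 1" "s < n - 9 - 1" by auto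
  then have "e = {X (1 + (s - 1)), X (1 + s)}" unfolding s(1) by (simp only: nth_map_upt)
  then have "e = {X s, X (1 + s)}" using s(3) by simp
  then show ?thesis using s(2) by (intro conjI exI[of _ "X s"] exI[of _ "X (1 + s)"]) simp_all
next
  case False
  then show ?thesis using assms unfolding edges413_def by auto
qed

text \<open>An edge of label \<open>k\<close> through \<open>v\<close> must be
  \<open>{v, \<rho> k v}\<close>, so two edges of the same label sharing a vertex coincide.\<close>

lemma wellformed: "lg_wellformed V (edges413 n)"
  unfolding lg_wellformed_def
proof (intro conjI ballI; clarify?)
  show "finite V" by (rule finite_V)
next
  fix e k assume ek: "(e, k) \<in> edges413 n"
  then obtain a b where ab: "k < 6" "a \<noteq> b" "e = {a, b}" using edge_form by blast
  then have "\<rho> k a = b" "\<rho> k b = a" using edge_iff ek by (metis insert_commute)+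
  then have "a \<in> V" "b \<in> V" using rho_permutes[OF ab(1)] ab(2) by (metis permutes_not_in)+
  then show "\<exists>a b. a \<noteq> b \<and> a \<in> V \<and> b \<in> V \<and> e = {a, b}" using ab by blast
next
  fix e k e' k' assume e: "(e, k) \<in> edges413 n" "(e', k) \<in> edges413 n" "e \<noteq> e'"
  have k: "k < 6" using e(1) edge_form by blast
  have "f = {v, \<rho> k v}" if f: "(f, k) \<in> edges413 n" "v \<in> f" for f v
  proof -
    obtain a b where ab: "a \<noteq> b" "f = {a, b}" using edge_form f(1) by blast
    then have "\<rho> k a = b" "\<rho> k b = a" using edge_iff[OF k] f(1) by (metis insert_commute)+
    then show ?thesis using ab f(2) by auto
  qed
  then show "e \<inter> e' = {}" using e by (metis disjoint_iff)
qed

lemma string_C: "string_C_group (group413 n) 6 \<rho>"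
  unfolding string_C_group_def sggi_def intersection_property_def
proof (intro conjI allI impI)
  show "group (group413 n)" by (rule group413_simps)
  show "generate (group413 n) (\<rho> ` {..<6}) = carrier (group413 n)"
    by (simp add: generate_group413 group413_simps)
next
  fix i :: nat assume i: "i < 6"
  show "\<rho> i \<in> carrier (group413 n)" using i gp_gen[of i "{..<6}" \<rho>] by (simp add: group413_simps)
  show "\<rho> i \<otimes>\<^bsub>group413 n\<^esub> \<rho> i = \<one>\<^bsub>group413 n\<^esub>"
    unfolding group413_simps using i by (rule rho_involution)
  have "\<exists>v. \<rho> i v \<noteq> v"
    using i
  proof (cases rule: less6_cases)
    case 1
    then show ?thesis using L5 by (intro exI[of _ "X 1"]) (simp add: rho0 swaps_X)
  next
    case 2
    then show ?thesis using L5 by (intro exI[of _ "X 2"]) (simp add: rho1[simplified] swaps_X)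
  next
    case (3 a)
    \<comment> \<open>\<open>Vg\<close> is moved by each of
      \<open>\<rho> 2, \<dots>, \<rho> 5\<close>.\<close>
    then show ?thesis by (intro exI[of _ Vg], cases a) (simp_all add: rho_label[of R2, simplified] rho_label[of R3, simplified]
       rho_label[of R4, simplified] rho_label[of R5, simplified] lift_simps emb_simps)
  qed
  then show "\<rho> i \<noteq> \<one>\<^bsub>group413 n\<^esub>" unfolding group413_simps by auto
next
  fix i j :: nat assume ij: "i < 6" "j < 6" "i + 2 \<le> j \<or> j + 2 \<le> i"
  then have c: "\<rho> i \<circ> \<rho> j = \<rho> j \<circ> \<rho> i" using rho_commute[of i j] rho_commute[of j i] by metis
  have "(\<rho> i \<circ> \<rho> j) \<circ> (\<rho> j \<circ> \<rho> i) = id"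
    using rho_involution[OF ij(1)] rho_involution[OF ij(2)] by (metis comp_assoc comp_id)
  then have "(\<rho> i \<circ> \<rho> j) ^^ 2 = id" unfolding c[symmetric] by (simp add: numeral_2_eq_2 del: comp_apply id_apply)
  then show "(\<rho> i \<otimes>\<^bsub>group413 n\<^esub> \<rho> j) [^]\<^bsub>group413 n\<^esub> (2::nat) = \<one>\<^bsub>group413 n\<^esub>"
    by (simp add: pow_eq_funpow group413_simps del: id_apply comp_apply)
next
  fix J K :: "nat set" assume "J \<subseteq> {..<6}" "K \<subseteq> {..<6}"
  moreover from this have "J \<inter> K \<subseteq> {..<6}" by blast
  ultimately show "generate (group413 n) (\<rho> ` J) \<inter> generate (group413 n) (\<rho> ` K) =
      generate (group413 n) (\<rho> ` (J \<inter> K))"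
    by (simp only: generate_group413 gp_inter)
qed

lemma schlafli: "schlafli_type (group413 n) 6 \<rho> [n - 10, 6, 3, 5, 3]"
  unfolding schlafli_type_def
proof (intro conjI allI impI)
  fix i :: nat assume "1 \<le> i \<and> i < 6"
  then consider "i = 1" | "i = 2" | "i = 3" | "i = 4" | "i = 5" by linarith
  then show "group.ord (group413 n) (\<rho> (i - 1) \<otimes>\<^bsub>group413 n\<^esub> \<rho> i) = [n - 10, 6, 3, 5, 3] ! (i - 1)"
    using ord_01 ord_12 ord_23 ord_34 ord_45 n_eq by cases simp_all
qed simp

end

theorem theorem4p13:
  fixes n :: nat
  assumes "n \<ge> 15" and "n mod 4 = 3"
  shows "lg_wellformed (verts413 n) (edges413 n)
    \<and> (\<forall>k<6. rho413 n k permutes verts413 n)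
    \<and> group413 n \<cong> alt_group n
    \<and> string_C_group (group413 n) 6 (rho413 n)
    \<and> schlafli_type (group413 n) 6 (rho413 n) [n - 10, 6, 3, 5, 3]"
proof -
  obtain k where "n = 4 * k + 3"
    using assms(2) by (metis mult_div_mod_eq)
  \<comment> \<open>Since \<open>n\<close> is at least 15, \<open>k\<close> is at least 3 and the
    natural subtractions are exact; \<open>L\<close> is 1 modulo 4.\<close>
  then have "n - 10 = 4 * (k - 2) + 1" "n = n - 10 + 10" "n - 10 \<ge> 5"
    using assms(1) by auto
  then interpret graph413 n "n - 10"
    by unfold_locales simp_all
  show ?thesis
    by (intro conjI allI impI wellformed rho_permutes group413_iso string_C schlafli)
qed

end
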